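(* Let $\mathsf C$ be a Markov category with conditionals. Let (A) and (B) be composable commutative squares in $\mathcal S(\mathsf C)$: (A) consists of $f_1:\Omega\to X_1$, $f_2:\Omega\to X_2$, $g_1:X_1\to Y_2$, $g_2:X_2\to Y_2$ with $g_1f_1=g_2f_2$; (B) consists of $h_1:X_1\to Y_1$, $g_1:X_1\to Y_2$, $k:Y_1\to Z$, $h_2:Y_2\to Z$ with $kh_1=h_2g_1$. If the composite square (AB), consisting of $h_1f_1:\Omega\to Y_1$, $f_2:\Omega\to X_2$, $k:Y_1\to Z$, $h_2g_2:X_2\to Z$, is independent and (B) is an independent pullback, then (A) is independent.
   Context: A Markov category is a symmetric monoidal category $(\mathsf C,\otimes,I)$ (coherence isomorphisms suppressed) whose unit $I$ is terminal and in which every object $X$ carries a commutative comonoid structure $\mathrm{copy}_X:X\to X\otimes X$, $\mathrm{del}_X:X\to I$ compatible with the monoidal structure ($\mathrm{copy}_{X\otimes Y}$ is $\mathrm{copy}_X\otimes\mathrm{copy}_Y$ followed by the swap of the two middle factors, $\mathrm{del}_{X\otimes Y}=\mathrm{del}_X\otimes\mathrm{del}_Y$, and the structure on $I$ is trivial). The projections $\pi_X:X\otimes Y\to X$, $\pi_Y:X\otimes Y\to Y$ are obtained by deleting the other factor. For $f:A\to X$, $g:A\to Y$ write $\langle f,g\rangle=(f\otimes g)\circ\mathrm{copy}_A$ (similarly for triples, using iterated copy). A state is a morphism $p:I\to X$. $\mathsf C$ has conditionals if for every $f:A\to X\otimes Y$ there is $f|_X:X\otimes A\to Y$ with $f=(\mathrm{id}_X\otimes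 f|_X)\circ(\mathrm{copy}_X\otimes \mathrm{id}_A)\circ((\pi_X f)\otimes\mathrm{id}_A)\circ\mathrm{copy}_A$. For $f,g:X\to Y$ and a state $p:I\to X$, $f=_p g$ ($p$-almost sure equality) means $\langle \mathrm{id}_X,f\rangle\circ p=\langle\mathrm{id}_X,g\rangle\circ p$; $f$ is $p$-almost surely deterministic if $\mathrm{copy}_Y\circ f=_p(f\otimes f)\circ\mathrm{copy}_X$. The category $\mathcal P(\mathsf C)$ of probability spaces has objects $(\Omega,p)$ with $p:I\to\Omega$ a state; morphisms $(\Omega,p)\to(\Omega',q)$ are $p$-almost sure equality classes of $f:\Omega\to\Omega'$ with $f\circ p=q$; composition is that of $\mathsf C$ on representatives. The category $\mathcal S(\mathsf C)$ of sample spaces is the wide subcategory of $\mathcal P(\mathsf C)$ of classes of $p$-almost surely deterministic morphisms. A sample space is denoted by its underlying object $\Omega$, with state $p_\Omega$. A commutative square in $\mathcal S(\mathsf C)$ consisting of $f:\Omega\to X$, $g:\Omega\to Y$, $u:X\to Z$, $v:Y\to Z$ with $d:=uf=vg$ is called independent if there exist morphisms $\phi:Z\to X$ and $\psi:Z\to Y$ in $\mathsf C$ such that $\langle f,d,g\rangle\circ p_\Omega=\langle\phi,\mathrm{id}_Z,\psi\rangle\circ p_Z$ as states $I\to X\otimes Z\otimes Y$. It is an independent pullback if it is independent and for every independent square $f':\Omega'\to X$, $g':\Omega'\to Y$ over the same cospan $(u,v)$ there is a unique morphism $h:\Omega'\to\Omega$ in $\mathcal S(\mathsf C)$ with $fh=f'$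 and $gh=g'$. *)

theory Defs
  imports Main
begin

section \<open>Categories\<close>

record ('o, 'm) cat =
  Ob :: "'o set"
  Arr :: "'m set"
  Dom :: "'m \<Rightarrow> 'o"
  Cod :: "'m \<Rightarrow> 'o"
  ident :: "'o \<Rightarrow> 'm" (\<open>\<iota>\<index>\<close>)
  comp :: "'m \<Rightarrow> 'm \<Rightarrow> 'm" (infixr \<open>\<cdot>\<index>\<close> 65)

text \<open>Composition is written in the usual order: \<open>g \<cdot> f\<close> is \<open>f\<close> followed by \<open>g\<close>.\<close>

definition hom :: "('o, 'm, 'z) cat_scheme \<Rightarrow> 'o \<Rightarrow> 'o \<Rightarrow> 'm set" where
  "hom C X Y = {f \<in> Arr C. Dom C f = X \<and> Cod C f = Y}"

locale category =
  fixes C :: "('o, 'm, 'z) cat_scheme" (structure)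
  assumes Dom_Ob: "f \<in> Arr C \<Longrightarrow> Dom C f \<in> Ob C"
    and Cod_Ob: "f \<in> Arr C \<Longrightarrow> Cod C f \<in> Ob C"
    and ident_hom: "X \<in> Ob C \<Longrightarrow> \<iota> X \<in> hom C X X"
    and comp_hom: "\<lbrakk>f \<in> hom C X Y; g \<in> hom C Y Z\<rbrakk> \<Longrightarrow> g \<cdot> f \<in> hom C X Z"
    and comp_ident: "f \<in> hom C X Y \<Longrightarrow> f \<cdot> \<iota> X = f"
    and ident_comp: "f \<in> hom C X Y \<Longrightarrow> \<iota> Y \<cdot> f = f"
    and comp_assoc:
      "\<lbrakk>f \<in> hom C W X; g \<in> hom C X Y; h \<in> hom C Y Z\<rbrakk> \<Longrightarrow> (h \<cdot> g) \<cdot> f = h \<cdot> (g \<cdot> f)"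

definition inverse_arrs :: "('o, 'm, 'z) cat_scheme \<Rightarrow> 'm \<Rightarrow> 'm \<Rightarrow> bool" where
  "inverse_arrs C f g \<longleftrightarrow> f \<in> Arr C \<and> g \<in> hom C (Cod C f) (Dom C f)
     \<and> comp C g f = ident C (Dom C f) \<and> comp C f g = ident C (Cod C f)"

definition iso :: "('o, 'm, 'z) cat_scheme \<Rightarrow> 'm \<Rightarrow> bool" where
  "iso C f \<longleftrightarrow> (\<exists>g. inverse_arrs C f g)"

definition inv_arr :: "('o, 'm, 'z) cat_scheme \<Rightarrow> 'm \<Rightarrow> 'm" where
  "inv_arr C f = (THE g. inverse_arrs C f g)"

definition comm_square ::
    "('o, 'm, 'z) cat_scheme \<Rightarrow> 'm \<Rightarrow> 'm \<Rightarrow> 'm \<Rightarrow> 'm \<Rightarrow> bool" where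
  "comm_square C f g u v \<longleftrightarrow>
     (\<exists>W X Y Z. f \<in> hom C W X \<and> g \<in> hom C W Y \<and> u \<in> hom C X Z \<and> v \<in> hom C Y Z)
     \<and> comp C u f = comp C v g"


section \<open>Symmetric monoidal categories\<close>

record ('o, 'm) smc = "('o, 'm) cat" +
  unit :: "'o"
  tensO :: "'o \<Rightarrow> 'o \<Rightarrow> 'o" (infixr \<open>\<boxtimes>\<index>\<close> 75)
  tensM :: "'m \<Rightarrow> 'm \<Rightarrow> 'm" (infixr \<open>\<otimes>\<index>\<close> 75)
  assoc :: "'o \<Rightarrow> 'o \<Rightarrow> 'o \<Rightarrow> 'm" (\<open>\<alpha>\<index>\<close>)
  lunit :: "'o \<Rightarrow> 'm" (\<open>\<l>\<index>\<close>)
  runit :: "'o \<Rightarrow> 'm" (\<open>\<r>\<index>\<close>)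
  swap :: "'o \<Rightarrow> 'o \<Rightarrow> 'm" (\<open>\<sigma>\<index>\<close>)

text \<open>\<open>\<boxtimes>\<close> is the tensor product of objects, \<open>\<otimes>\<close> that of morphisms. The monoidal structure
  is not assumed to be strict.\<close>

locale symmetric_monoidal_category = category C
  for C :: "('o, 'm, 'z) smc_scheme" (structure) +
  assumes unit_Ob: "unit C \<in> Ob C"
    and tensO_Ob: "\<lbrakk>X \<in> Ob C; Y \<in> Ob C\<rbrakk> \<Longrightarrow> X \<boxtimes> Y \<in> Ob C"
    and tensM_hom: "\<lbrakk>f \<in> hom C X X'; g \<in> hom C Y Y'\<rbrakk> \<Longrightarrow> f \<otimes> g \<in> hom C (X \<boxtimes> Y) (X' \<boxtimes> Y')"
    and tensM_ident: "\<lbrakk>X \<in> Ob C; Y \<in> Ob C\<rbrakk> \<Longrightarrow> \<iota> X \<otimes> \<iota> Y = \<iota> (X \<boxtimes> Y)"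
    and tensM_comp:
      "\<lbrakk>f \<in> hom C X X'; f' \<in> hom C X' X''; g \<in> hom C Y Y'; g' \<in> hom C Y' Y''\<rbrakk>
        \<Longrightarrow> (f' \<cdot> f) \<otimes> (g' \<cdot> g) = (f' \<otimes> g') \<cdot> (f \<otimes> g)"
    and assoc_hom: "\<lbrakk>X \<in> Ob C; Y \<in> Ob C; Z \<in> Ob C\<rbrakk>
        \<Longrightarrow> \<alpha> X Y Z \<in> hom C ((X \<boxtimes> Y) \<boxtimes> Z) (X \<boxtimes> (Y \<boxtimes> Z))"
    and lunit_hom: "X \<in> Ob C \<Longrightarrow> \<l> X \<in> hom C (unit C \<boxtimes> X) X"
    and runit_hom: "X \<in> Ob C \<Longrightarrow> \<r> X \<in> hom C (X \<boxtimes> unit C) X"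
    and swap_hom: "\<lbrakk>X \<in> Ob C; Y \<in> Ob C\<rbrakk> \<Longrightarrow> \<sigma> X Y \<in> hom C (X \<boxtimes> Y) (Y \<boxtimes> X)"
    and assoc_iso: "\<lbrakk>X \<in> Ob C; Y \<in> Ob C; Z \<in> Ob C\<rbrakk> \<Longrightarrow> iso C (\<alpha> X Y Z)"
    and lunit_iso: "X \<in> Ob C \<Longrightarrow> iso C (\<l> X)"
    and runit_iso: "X \<in> Ob C \<Longrightarrow> iso C (\<r> X)"
    and assoc_natural: "\<lbrakk>f \<in> hom C X X'; g \<in> hom C Y Y'; h \<in> hom C Z Z'\<rbrakk>
        \<Longrightarrow> \<alpha> X' Y' Z' \<cdot> ((f \<otimes> g) \<otimes> h) = (f \<otimes> (g \<otimes> h)) \<cdot> \<alpha> X Y Z"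
    and lunit_natural: "f \<in> hom C X X' \<Longrightarrow> \<l> X' \<cdot> (\<iota> (unit C) \<otimes> f) = f \<cdot> \<l> X"
    and runit_natural: "f \<in> hom C X X' \<Longrightarrow> \<r> X' \<cdot> (f \<otimes> \<iota> (unit C)) = f \<cdot> \<r> X"
    and swap_natural: "\<lbrakk>f \<in> hom C X X'; g \<in> hom C Y Y'\<rbrakk>
        \<Longrightarrow> \<sigma> X' Y' \<cdot> (f \<otimes> g) = (g \<otimes> f) \<cdot> \<sigma> X Y"
    and pentagon: "\<lbrakk>W \<in> Ob C; X \<in> Ob C; Y \<in> Ob C; Z \<in> Ob C\<rbrakk>
        \<Longrightarrow> \<alpha> W X (Y \<boxtimes> Z) \<cdot> \<alpha> (W \<boxtimes> X) Y Z
            = (\<iota> W \<otimes> \<alpha> X Y Z) \<cdot> \<alpha> W (X \<boxtimes> Y) Z \<cdot> (\<alpha> W X Y \<otimes> \<iota> Z)"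
    and triangle: "\<lbrakk>X \<in> Ob C; Y \<in> Ob C\<rbrakk>
        \<Longrightarrow> (\<iota> X \<otimes> \<l> Y) \<cdot> \<alpha> X (unit C) Y = \<r> X \<otimes> \<iota> Y"
    and hexagon: "\<lbrakk>X \<in> Ob C; Y \<in> Ob C; Z \<in> Ob C\<rbrakk>
        \<Longrightarrow> \<alpha> Y Z X \<cdot> \<sigma> X (Y \<boxtimes> Z) \<cdot> \<alpha> X Y Z
            = (\<iota> Y \<otimes> \<sigma> X Z) \<cdot> \<alpha> Y X Z \<cdot> (\<sigma> X Y \<otimes> \<iota> Z)"
    and swap_swap: "\<lbrakk>X \<in> Ob C; Y \<in> Ob C\<rbrakk> \<Longrightarrow> \<sigma> Y X \<cdot> \<sigma> X Y = \<iota> (X \<boxtimes> Y)"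

text \<open>Swap of the two middle factors, \<open>(W \<boxtimes> X) \<boxtimes> (Y \<boxtimes> Z) \<rightarrow> (W \<boxtimes> Y) \<boxtimes> (X \<boxtimes> Z)\<close>.\<close>

definition middle_swap ::
    "('o, 'm, 'z) smc_scheme \<Rightarrow> 'o \<Rightarrow> 'o \<Rightarrow> 'o \<Rightarrow> 'o \<Rightarrow> 'm" where
  "middle_swap C W X Y Z =
     inv_arr C (assoc C W Y (tensO C X Z))
     \<cdot>\<^bsub>C\<^esub> (ident C W \<otimes>\<^bsub>C\<^esub>
            (assoc C Y X Z \<cdot>\<^bsub>C\<^esub> (swap C X Y \<otimes>\<^bsub>C\<^esub> ident C Z) \<cdot>\<^bsub>C\<^esub> inv_arr C (assoc C X Y Z)))
     \<cdot>\<^bsub>C\<^esub> assoc C W X (tensO C Y Z)"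


section \<open>Markov categories\<close>

record ('o, 'm) markov = "('o, 'm) smc" +
  copy :: "'o \<Rightarrow> 'm"
  del :: "'o \<Rightarrow> 'm"

locale markov_category = symmetric_monoidal_category C
  for C :: "('o, 'm, 'z) markov_scheme" (structure) +
  assumes unit_terminal: "X \<in> Ob C \<Longrightarrow> \<exists>!f. f \<in> hom C X (unit C)"
    and copy_hom: "X \<in> Ob C \<Longrightarrow> copy C X \<in> hom C X (X \<boxtimes> X)"
    and del_hom: "X \<in> Ob C \<Longrightarrow> del C X \<in> hom C X (unit C)"
    and copy_coassoc: "X \<in> Ob C \<Longrightarrow>
        \<alpha> X X X \<cdot> (copy C X \<otimes> \<iota> X) \<cdot> copy C X = (\<iota> X \<otimes> copy C X) \<cdot> copy C X"
    and copy_counit_left: "X \<in> Ob C \<Longrightarrow> \<l> X \<cdot> (del C X \<otimes> \<iota> X) \<cdot> copy C X = \<iota> X"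
    and copy_counit_right: "X \<in> Ob C \<Longrightarrow> \<r> X \<cdot> (\<iota> X \<otimes> del C X) \<cdot> copy C X = \<iota> X"
    and copy_cocomm: "X \<in> Ob C \<Longrightarrow> \<sigma> X X \<cdot> copy C X = copy C X"
    and copy_tens: "\<lbrakk>X \<in> Ob C; Y \<in> Ob C\<rbrakk> \<Longrightarrow>
        copy C (X \<boxtimes> Y) = middle_swap C X X Y Y \<cdot> (copy C X \<otimes> copy C Y)"
    and del_tens: "\<lbrakk>X \<in> Ob C; Y \<in> Ob C\<rbrakk> \<Longrightarrow>
        del C (X \<boxtimes> Y) = \<l> (unit C) \<cdot> (del C X \<otimes> del C Y)"
    and copy_unit: "copy C (unit C) = inv_arr C (\<l> (unit C))"
    and del_unit: "del C (unit C) = \<iota> (unit C)"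

definition proj1 :: "('o, 'm, 'z) markov_scheme \<Rightarrow> 'o \<Rightarrow> 'o \<Rightarrow> 'm" where
  "proj1 C X Y = runit C X \<cdot>\<^bsub>C\<^esub> (ident C X \<otimes>\<^bsub>C\<^esub> del C Y)"

definition pair :: "('o, 'm, 'z) markov_scheme \<Rightarrow> 'm \<Rightarrow> 'm \<Rightarrow> 'm" where
  "pair C f g = (f \<otimes>\<^bsub>C\<^esub> g) \<cdot>\<^bsub>C\<^esub> copy C (Dom C f)"

definition triple :: "('o, 'm, 'z) markov_scheme \<Rightarrow> 'm \<Rightarrow> 'm \<Rightarrow> 'm \<Rightarrow> 'm" where
  "triple C f g h =
     (f \<otimes>\<^bsub>C\<^esub> (g \<otimes>\<^bsub>C\<^esub> h)) \<cdot>\<^bsub>C\<^esub> (ident C (Dom C f) \<otimes>\<^bsub>C\<^esub> copy C (Dom C f)) \<cdot>\<^bsub>C\<^esub> copy C (Dom C f)"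

definition has_conditionals :: "('o, 'm, 'z) markov_scheme \<Rightarrow> bool" where
  "has_conditionals C \<longleftrightarrow>
     (\<forall>A\<in>Ob C. \<forall>X\<in>Ob C. \<forall>Y\<in>Ob C. \<forall>f\<in>hom C A (tensO C X Y).
        \<exists>c\<in>hom C (tensO C X A) Y.
          f = (ident C X \<otimes>\<^bsub>C\<^esub> c) \<cdot>\<^bsub>C\<^esub> assoc C X X A \<cdot>\<^bsub>C\<^esub> (copy C X \<otimes>\<^bsub>C\<^esub> ident C A)
              \<cdot>\<^bsub>C\<^esub> ((proj1 C X Y \<cdot>\<^bsub>C\<^esub> f) \<otimes>\<^bsub>C\<^esub> ident C A) \<cdot>\<^bsub>C\<^esub> copy C A)"

definition as_eq :: "('o, 'm, 'z) markov_scheme \<Rightarrow> 'm \<Rightarrow> 'm \<Rightarrow> 'm \<Rightarrow> bool" where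
  "as_eq C p f g \<longleftrightarrow>
     pair C (ident C (Cod C p)) f \<cdot>\<^bsub>C\<^esub> p = pair C (ident C (Cod C p)) g \<cdot>\<^bsub>C\<^esub> p"

definition as_deterministic :: "('o, 'm, 'z) markov_scheme \<Rightarrow> 'm \<Rightarrow> 'm \<Rightarrow> bool" where
  "as_deterministic C p f \<longleftrightarrow>
     as_eq C p (copy C (Cod C f) \<cdot>\<^bsub>C\<^esub> f) ((f \<otimes>\<^bsub>C\<^esub> f) \<cdot>\<^bsub>C\<^esub> copy C (Dom C f))"


section \<open>Probability spaces and sample spaces\<close>

text \<open>The object \<open>(\<Omega>, p)\<close> of \<open>Prob C\<close> is a pair; an arrow of \<open>Prob C\<close> is a triple \<open>(S, T, F)\<close>
  of source, target and almost sure equality class.\<close>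

type_synonym ('o, 'm) space = "'o \<times> 'm"
type_synonym ('o, 'm) space_arr = "('o, 'm) space \<times> ('o, 'm) space \<times> 'm set"

definition prob_spaces :: "('o, 'm, 'z) markov_scheme \<Rightarrow> ('o, 'm) space set" where
  "prob_spaces C = {(X, p). X \<in> Ob C \<and> p \<in> hom C (unit C) X}"

definition state_preserving ::
    "('o, 'm, 'z) markov_scheme \<Rightarrow> ('o, 'm) space \<Rightarrow> ('o, 'm) space \<Rightarrow> 'm set" where
  "state_preserving C S T = {f \<in> hom C (fst S) (fst T). f \<cdot>\<^bsub>C\<^esub> snd S = snd T}"

definition as_rel ::
    "('o, 'm, 'z) markov_scheme \<Rightarrow> ('o, 'm) space \<Rightarrow> ('o, 'm) space \<Rightarrow> ('m \<times> 'm) set" where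
  "as_rel C S T =
     {(f, g) \<in> state_preserving C S T \<times> state_preserving C S T. as_eq C (snd S) f g}"

definition Prob ::
    "('o, 'm, 'z) markov_scheme \<Rightarrow> (('o, 'm) space, ('o, 'm) space_arr) cat" where
  "Prob C = \<lparr>
     Ob = prob_spaces C,
     Arr = {(S, T, F). S \<in> prob_spaces C \<and> T \<in> prob_spaces C
                       \<and> F \<in> state_preserving C S T // as_rel C S T},
     Dom = (\<lambda>(S, T, F). S),
     Cod = (\<lambda>(S, T, F). T),
     ident = (\<lambda>S. (S, S, as_rel C S S `` {ident C (fst S)})),
     comp = (\<lambda>(T', U, G) (S, T, F).
               (S, U, \<Union>f\<in>F. \<Union>g\<in>G. as_rel C S U `` {g \<cdot>\<^bsub>C\<^esub> f}))\<rparr>"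

definition Sample ::
    "('o, 'm, 'z) markov_scheme \<Rightarrow> (('o, 'm) space, ('o, 'm) space_arr) cat" where
  "Sample C = (Prob C)\<lparr>
     Arr := {(S, T, F) \<in> Arr (Prob C). \<forall>f\<in>F. as_deterministic C (snd S) f}\<rparr>"

abbreviation rep :: "('o, 'm) space_arr \<Rightarrow> 'm set" where
  "rep F \<equiv> snd (snd F)"


section \<open>Independent squares and independent pullbacks\<close>

text \<open>The state \<open>\<langle>f, d, g\<rangle> \<circ> p\<close> does not depend on the representatives, so it is
  immaterial that they are quantified existentially here.\<close>

definition independent ::
    "('o, 'm, 'z) markov_scheme \<Rightarrow> ('o, 'm) space_arr \<Rightarrow> ('o, 'm) space_arr
       \<Rightarrow> ('o, 'm) space_arr \<Rightarrow> ('o, 'm) space_arr \<Rightarrow> bool" where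
  "independent C f g u v \<longleftrightarrow> comm_square (Sample C) f g u v \<and>
     (let (\<Omega>, p) = Dom (Sample C) f; (X, _) = Cod (Sample C) f;
          (Y, _) = Cod (Sample C) g; (Z, q) = Cod (Sample C) u;
          d = u \<cdot>\<^bsub>Sample C\<^esub> f
      in \<exists>f\<^sub>0\<in>rep f. \<exists>d\<^sub>0\<in>rep d. \<exists>g\<^sub>0\<in>rep g. \<exists>\<phi>\<in>hom C Z X. \<exists>\<psi>\<in>hom C Z Y.
           triple C f\<^sub>0 d\<^sub>0 g\<^sub>0 \<cdot>\<^bsub>C\<^esub> p = triple C \<phi> (ident C Z) \<psi> \<cdot>\<^bsub>C\<^esub> q)"

definition independent_pullback ::
    "('o, 'm, 'z) markov_scheme \<Rightarrow> ('o, 'm) space_arr \<Rightarrow> ('o, 'm) space_arr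
       \<Rightarrow> ('o, 'm) space_arr \<Rightarrow> ('o, 'm) space_arr \<Rightarrow> bool" where
  "independent_pullback C f g u v \<longleftrightarrow> independent C f g u v \<and>
     (\<forall>f' g'. independent C f' g' u v \<longrightarrow>
        (\<exists>!h. h \<in> hom (Sample C) (Dom (Sample C) f') (Dom (Sample C) f)
              \<and> f \<cdot>\<^bsub>Sample C\<^esub> h = f' \<and> g \<cdot>\<^bsub>Sample C\<^esub> h = g'))"

end

theory Submission
  imports Defs
begin

text \<open>Independence of a square over \<open>Z\<close> is conditional independence: the two variables on the apex are
  independent given their common image in \<open>Z\<close>. Put \<open>a = h\<^sub>1 f\<^sub>1\<close>, \<open>b = g\<^sub>1 f\<^sub>1 = g\<^sub>2 f\<^sub>2\<close> and
  \<open>d = k a = h\<^sub>2 b\<close>. The hypothesis on the composite square says that \<open>a\<close> and \<open>f\<^sub>2\<close> are independent given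
  \<open>d\<close>; the goal is that \<open>f\<^sub>1\<close> and \<open>f\<^sub>2\<close> are independent given \<open>b\<close>.

  As \<open>d\<close> is a function of \<open>b\<close> and \<open>b\<close> is a function of \<open>f\<^sub>2\<close>, the weak union rule strengthens the
  hypothesis to: \<open>a\<close> and \<open>f\<^sub>2\<close> are independent given \<open>b\<close>
  (\<open>conditional_independence_weak_union\<close>). The pullback enters only through the fact that its apex \<open>X\<^sub>1\<close> is
  determined by its two sides: there is \<open>s : Y\<^sub>1 \<boxtimes> Y\<^sub>2 \<rightarrow> X\<^sub>1\<close> with \<open>s \<cdot> \<langle>h\<^sub>1, g\<^sub>1\<rangle> = id\<close> almost surely
  (\<open>independent_pullback_reconstruction\<close>). Consequently \<open>f\<^sub>1 = s \<cdot> \<langle>a, b\<rangle>\<close> almost surely, and a function of \<open>a\<close> and \<open>b\<close>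
  is independent of \<open>f\<^sub>2\<close> given \<open>b\<close> whenever \<open>a\<close> is (\<open>conditional_independence_function\<close>).

  The existence of \<open>s\<close> comes from the uniqueness half of the universal property. Take two copies of
  \<open>X\<^sub>1\<close>, conditionally independent given the value of \<open>\<langle>h\<^sub>1, g\<^sub>1\<rangle>\<close>. Both projections to \<open>X\<^sub>1\<close> induce the same
  independent square over the cospan, so they agree almost surely. Hence the conditional law of a
  point of \<open>X\<^sub>1\<close> given \<open>\<langle>h\<^sub>1, g\<^sub>1\<rangle>\<close> yields the same point in two independent draws, and this conditional
  law is the wanted \<open>s\<close>. Conditionals are needed for disintegrations, and also to recognise almost
  sure equality of two variables from their joint law (\<open>as_eq_if_diagonal\<close>).

  The monoidal structure is not strict. Coherence is confined to the proof that the
  projections of a product are deterministic and jointly form the identity (\<open>copy_proj\<close>); for this,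
  three unit laws suffice.\<close>


section \<open>Typing of composites\<close>

context category
begin

lemma homD:
  "f \<in> hom C X Y \<Longrightarrow> f \<in> Arr C \<and> Dom C f = X \<and> Cod C f = Y \<and> X \<in> Ob C \<and> Y \<in> Ob C"
  by (auto simp: hom_def Dom_Ob Cod_Ob)

lemma homI: "f \<in> Arr C \<Longrightarrow> f \<in> hom C (Dom C f) (Cod C f)"
  by (simp add: hom_def)

lemma Dom_Cod_Ob [simp]: "f \<in> Arr C \<Longrightarrow> Dom C f \<in> Ob C" "f \<in> Arr C \<Longrightarrow> Cod C f \<in> Ob C"
  by (simp_all add: Dom_Ob Cod_Ob)

lemma ident_typing [simp]:
  assumes "X \<in> Ob C"
  shows "\<iota> X \<in> Arr C" "Dom C (\<iota> X) = X" "Cod C (\<iota> X) = X"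
  using ident_hom[OF assms] by (auto dest: homD)

lemma comp_typing [simp]:
  assumes "f \<in> Arr C" "g \<in> Arr C" "Dom C g = Cod C f"
  shows "g \<cdot> f \<in> Arr C" "Dom C (g \<cdot> f) = Dom C f" "Cod C (g \<cdot> f) = Cod C g"
  using comp_hom[of f "Dom C f" "Cod C f" g "Cod C g"] assms by (auto simp: hom_def)

lemma comp_ident' [simp]: "\<lbrakk>f \<in> Arr C; Dom C f = X\<rbrakk> \<Longrightarrow> f \<cdot> \<iota> X = f"
  using comp_ident homI by blast

lemma ident_comp' [simp]: "\<lbrakk>f \<in> Arr C; Cod C f = X\<rbrakk> \<Longrightarrow> \<iota> X \<cdot> f = f"
  using ident_comp homI by blast

lemma comp_assoc' [simp]:
  "\<lbrakk>f \<in> Arr C; g \<in> Arr C; h \<in> Arr C; Dom C g = Cod C f; Dom C h = Cod C g\<rbrakk>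
    \<Longrightarrow> (h \<cdot> g) \<cdot> f = h \<cdot> g \<cdot> f"
  by (rule comp_assoc) (auto simp: hom_def)

text \<open>An equation between composites, extended by a further factor on the right. Composites are
  kept associated to the right, so a rule rewriting \<open>g \<cdot> f\<close> must also be available inside
  \<open>g \<cdot> (f \<cdot> x)\<close>.\<close>

lemma comp_extend:
  assumes "g \<cdot> f = e" "f \<in> Arr C" "g \<in> Arr C" "Dom C g = Cod C f" "x \<in> Arr C" "Cod C x = Dom C f"
  shows "g \<cdot> f \<cdot> x = e \<cdot> x"
  using assms comp_assoc' by metis

text \<open>Needed to know that the arrow described by \<open>inv_arr\<close> really is an inverse.\<close>

lemma inverse_arrs_unique:
  assumes "inverse_arrs C f g" "inverse_arrs C f g'"
  shows "g = g'"
proof -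
  have [simp]: "f \<in> Arr C" "g \<in> Arr C" "g' \<in> Arr C" "Dom C g = Cod C f" "Cod C g = Dom C f"
    "Dom C g' = Cod C f" "Cod C g' = Dom C f" "f \<cdot> g = \<iota> (Cod C f)" "g' \<cdot> f = \<iota> (Dom C f)"
    using assms by (auto simp: inverse_arrs_def hom_def)
  have "g = (g' \<cdot> f) \<cdot> g" by simp
  also have "\<dots> = g' \<cdot> (f \<cdot> g)" by (rule comp_assoc') simp_all
  finally show ?thesis by simp
qed

lemma inv_arr:
  assumes "iso C f"
  shows "f \<in> Arr C" "inv_arr C f \<in> Arr C" "Dom C (inv_arr C f) = Cod C f"
    "Cod C (inv_arr C f) = Dom C f" "inv_arr C f \<cdot> f = \<iota> (Dom C f)" "f \<cdot> inv_arr C f = \<iota> (Cod C f)"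
proof -
  have "\<exists>!g. inverse_arrs C f g"
    using assms inverse_arrs_unique by (auto simp: iso_def)
  then have "inverse_arrs C f (inv_arr C f)"
    unfolding inv_arr_def by (rule theI')
  then show "f \<in> Arr C" "inv_arr C f \<in> Arr C" "Dom C (inv_arr C f) = Cod C f"
    "Cod C (inv_arr C f) = Dom C f" "inv_arr C f \<cdot> f = \<iota> (Dom C f)" "f \<cdot> inv_arr C f = \<iota> (Cod C f)"
    by (auto simp: inverse_arrs_def hom_def)
qed

lemma iso_cancel_left:
  assumes "iso C e" "f \<in> Arr C" "g \<in> Arr C" "Cod C f = Dom C e" "Cod C g = Dom C e"
    "e \<cdot> f = e \<cdot> g"
  shows "f = g"
proof -
  note [simp] = inv_arr[OF assms(1)] assms(2-5)
  have "(inv_arr C e \<cdot> e) \<cdot> f = (inv_arr C e \<cdot> e) \<cdot> g"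
    using assms(6) comp_assoc'[of f e "inv_arr C e"] comp_assoc'[of g e "inv_arr C e"]
    by (simp del: comp_assoc')
  then show ?thesis by simp
qed

lemma iso_cancel_right:
  assumes "iso C e" "f \<in> Arr C" "g \<in> Arr C" "Dom C f = Cod C e" "Dom C g = Cod C e"
    "f \<cdot> e = g \<cdot> e"
  shows "f = g"
proof -
  note [simp] = inv_arr[OF assms(1)] assms(2-5)
  have "(f \<cdot> e) \<cdot> inv_arr C e = (g \<cdot> e) \<cdot> inv_arr C e" using assms(6) by simp
  then show ?thesis by simp
qed

end


section \<open>Unit coherence\<close>

context symmetric_monoidal_category
begin

declare unit_Ob [simp] tensO_Ob [simp]

lemma tensM_typing [simp]:
  assumes "f \<in> Arr C" "g \<in> Arr C"
  shows "f \<otimes> g \<in> Arr C" "Dom C (f \<otimes> g) = Dom C f \<boxtimes> Dom C g"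
    "Cod C (f \<otimes> g) = Cod C f \<boxtimes> Cod C g"
  using tensM_hom[OF homI homI, OF assms] by (auto dest: homD)

lemma assoc_typing [simp]:
  assumes "X \<in> Ob C" "Y \<in> Ob C" "Z \<in> Ob C"
  shows "\<alpha> X Y Z \<in> Arr C" "Dom C (\<alpha> X Y Z) = (X \<boxtimes> Y) \<boxtimes> Z"
    "Cod C (\<alpha> X Y Z) = X \<boxtimes> (Y \<boxtimes> Z)"
  using assoc_hom[OF assms] by (auto dest: homD)

lemma lunit_typing [simp]:
  assumes "X \<in> Ob C"
  shows "\<l> X \<in> Arr C" "Dom C (\<l> X) = unit C \<boxtimes> X" "Cod C (\<l> X) = X"
  using lunit_hom[OF assms] by (auto dest: homD)

lemma runit_typing [simp]:
  assumes "X \<in> Ob C"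
  shows "\<r> X \<in> Arr C" "Dom C (\<r> X) = X \<boxtimes> unit C" "Cod C (\<r> X) = X"
  using runit_hom[OF assms] by (auto dest: homD)

lemma swap_typing [simp]:
  assumes "X \<in> Ob C" "Y \<in> Ob C"
  shows "\<sigma> X Y \<in> Arr C" "Dom C (\<sigma> X Y) = X \<boxtimes> Y" "Cod C (\<sigma> X Y) = Y \<boxtimes> X"
  using swap_hom[OF assms] by (auto dest: homD)

lemma tensM_comp' [simp]:
  assumes "f \<in> Arr C" "f' \<in> Arr C" "g \<in> Arr C" "g' \<in> Arr C" "Dom C f' = Cod C f" "Dom C g' = Cod C g"
  shows "(f' \<otimes> g') \<cdot> (f \<otimes> g) = (f' \<cdot> f) \<otimes> (g' \<cdot> g)"
  by (rule tensM_comp[symmetric]) (use assms in \<open>auto simp: hom_def\<close>)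

lemma tensM_comp_extend [simp]:
  assumes "f \<in> Arr C" "f' \<in> Arr C" "g \<in> Arr C" "g' \<in> Arr C" "Dom C f' = Cod C f" "Dom C g' = Cod C g"
    "x \<in> Arr C" "Cod C x = Dom C f \<boxtimes> Dom C g"
  shows "(f' \<otimes> g') \<cdot> (f \<otimes> g) \<cdot> x = ((f' \<cdot> f) \<otimes> (g' \<cdot> g)) \<cdot> x"
  by (rule comp_extend[OF tensM_comp']) (use assms in auto)

declare tensM_ident [simp]

text \<open>Since \<open>\<r>\<close> and \<open>\<l>\<close> are natural isomorphisms, tensoring with the unit is naturally isomorphic
  to the identity functor. The three coherence laws that follow are therefore proved after tensoring
  with the unit, where the pentagon, triangle and hexagon apply; this is Kelly's argument that they
  need not be assumed in the definition of a symmetric monoidal category.\<close>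

lemma tens_unit_faithful:
  assumes "f \<in> Arr C" "g \<in> Arr C" "Dom C f = Dom C g" "Cod C f = Cod C g"
  shows "f \<otimes> \<iota> (unit C) = g \<otimes> \<iota> (unit C) \<Longrightarrow> f = g"
    and "\<iota> (unit C) \<otimes> f = \<iota> (unit C) \<otimes> g \<Longrightarrow> f = g"
proof -
  note [simp] = assms
  assume "f \<otimes> \<iota> (unit C) = g \<otimes> \<iota> (unit C)"
  then have "f \<cdot> \<r> (Dom C g) = g \<cdot> \<r> (Dom C g)"
    using runit_natural[OF homI, of f] runit_natural[OF homI, of g] by simp
  then show "f = g" by - (rule iso_cancel_right[OF runit_iso[of "Dom C g"]], simp_all)
next
  note [simp] = assms
  assume "\<iota> (unit C) \<otimes> f = \<iota> (unit C) \<otimes> g"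
  then have "f \<cdot> \<l> (Dom C g) = g \<cdot> \<l> (Dom C g)"
    using lunit_natural[OF homI, of f] lunit_natural[OF homI, of g] by simp
  then show "f = g" by - (rule iso_cancel_right[OF lunit_iso[of "Dom C g"]], simp_all)
qed

lemma assoc_natural':
  assumes "f \<in> Arr C" "g \<in> Arr C" "h \<in> Arr C"
  shows "\<alpha> (Cod C f) (Cod C g) (Cod C h) \<cdot> ((f \<otimes> g) \<otimes> h)
    = (f \<otimes> (g \<otimes> h)) \<cdot> \<alpha> (Dom C f) (Dom C g) (Dom C h)"
  by (rule assoc_natural) (use assms in \<open>auto simp: hom_def\<close>)

text \<open>The pentagon for \<open>W, X, I, I\<close>, with both sides followed by \<open>\<l>\<close> on the last two factors: the
  triangle turns this into an equation of the two sides tensored with \<open>I\<close>.\<close>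

lemma runit_tens:
  assumes [simp]: "W \<in> Ob C" "X \<in> Ob C"
  shows "(\<iota> W \<otimes> \<r> X) \<cdot> \<alpha> W X (unit C) = \<r> (W \<boxtimes> X)"
proof -
  let ?I = "unit C"
  have "\<alpha> W X ?I \<cdot> (\<r> (W \<boxtimes> X) \<otimes> \<iota> ?I)
      = \<alpha> W X ?I \<cdot> (\<iota> (W \<boxtimes> X) \<otimes> \<l> ?I) \<cdot> \<alpha> (W \<boxtimes> X) ?I ?I"
    using triangle[of "W \<boxtimes> X" ?I] by simp
  also have "\<dots> = (\<alpha> W X ?I \<cdot> ((\<iota> W \<otimes> \<iota> X) \<otimes> \<l> ?I)) \<cdot> \<alpha> (W \<boxtimes> X) ?I ?I"
    by simp
  also have "\<dots> = ((\<iota> W \<otimes> (\<iota> X \<otimes> \<l> ?I)) \<cdot> \<alpha> W X (?I \<boxtimes> ?I)) \<cdot> \<alpha> (W \<boxtimes> X) ?I ?I"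
    using assoc_natural'[of "\<iota> W" "\<iota> X" "\<l> ?I"] by simp
  also have "\<dots> = (\<iota> W \<otimes> (\<iota> X \<otimes> \<l> ?I)) \<cdot> \<alpha> W X (?I \<boxtimes> ?I) \<cdot> \<alpha> (W \<boxtimes> X) ?I ?I"
    by simp
  also have "\<dots> = (\<iota> W \<otimes> (\<r> X \<otimes> \<iota> ?I)) \<cdot> \<alpha> W (X \<boxtimes> ?I) ?I \<cdot> (\<alpha> W X ?I \<otimes> \<iota> ?I)"
    using triangle[of X ?I] by (simp add: pentagon)
  also have "\<dots> = ((\<iota> W \<otimes> (\<r> X \<otimes> \<iota> ?I)) \<cdot> \<alpha> W (X \<boxtimes> ?I) ?I) \<cdot> (\<alpha> W X ?I \<otimes> \<iota> ?I)"
    by simp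
  also have "\<dots> = (\<alpha> W X ?I \<cdot> ((\<iota> W \<otimes> \<r> X) \<otimes> \<iota> ?I)) \<cdot> (\<alpha> W X ?I \<otimes> \<iota> ?I)"
    using assoc_natural'[of "\<iota> W" "\<r> X" "\<iota> ?I"] by (simp del: comp_assoc' tensM_ident)
  also have "\<dots> = \<alpha> W X ?I \<cdot> (((\<iota> W \<otimes> \<r> X) \<cdot> \<alpha> W X ?I) \<otimes> \<iota> ?I)"
    by simp
  finally have "\<r> (W \<boxtimes> X) \<otimes> \<iota> ?I = ((\<iota> W \<otimes> \<r> X) \<cdot> \<alpha> W X ?I) \<otimes> \<iota> ?I"
    by - (rule iso_cancel_left[OF assoc_iso[of W X ?I]], simp_all)
  then show ?thesis
    by - (rule tens_unit_faithful(1), simp_all)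
qed

text \<open>The pentagon for \<open>I, I, X, Y\<close>, followed by \<open>\<l>\<close> on \<open>I \<boxtimes> (X \<boxtimes> Y)\<close>.\<close>

lemma lunit_tens:
  assumes [simp]: "X \<in> Ob C" "Y \<in> Ob C"
  shows "\<l> (X \<boxtimes> Y) \<cdot> \<alpha> (unit C) X Y = \<l> X \<otimes> \<iota> Y"
proof -
  let ?I = "unit C"
  let ?e = "\<alpha> ?I (?I \<boxtimes> X) Y \<cdot> (\<alpha> ?I ?I X \<otimes> \<iota> Y)"
  have "(\<iota> ?I \<otimes> (\<l> (X \<boxtimes> Y) \<cdot> \<alpha> ?I X Y)) \<cdot> ?e
     = (\<iota> ?I \<otimes> \<l> (X \<boxtimes> Y)) \<cdot> \<alpha> ?I ?I (X \<boxtimes> Y) \<cdot> \<alpha> (?I \<boxtimes> ?I) X Y"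
    by (simp add: pentagon)
  also have "\<dots> = ((\<iota> ?I \<otimes> \<l> (X \<boxtimes> Y)) \<cdot> \<alpha> ?I ?I (X \<boxtimes> Y)) \<cdot> \<alpha> (?I \<boxtimes> ?I) X Y"
    by simp
  also have "\<dots> = (\<r> ?I \<otimes> (\<iota> X \<otimes> \<iota> Y)) \<cdot> \<alpha> (?I \<boxtimes> ?I) X Y"
    using triangle[of ?I "X \<boxtimes> Y"] by simp
  also have "\<dots> = \<alpha> ?I X Y \<cdot> ((\<r> ?I \<otimes> \<iota> X) \<otimes> \<iota> Y)"
    using assoc_natural'[of "\<r> ?I" "\<iota> X" "\<iota> Y"] by (simp del: tensM_ident)
  also have "\<dots> = \<alpha> ?I X Y \<cdot> (((\<iota> ?I \<otimes> \<l> X) \<cdot> \<alpha> ?I ?I X) \<otimes> \<iota> Y)"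
    using triangle[of ?I X] by simp
  also have "\<dots> = (\<alpha> ?I X Y \<cdot> ((\<iota> ?I \<otimes> \<l> X) \<otimes> \<iota> Y)) \<cdot> (\<alpha> ?I ?I X \<otimes> \<iota> Y)"
    by simp
  also have "\<dots> = (\<iota> ?I \<otimes> (\<l> X \<otimes> \<iota> Y)) \<cdot> ?e"
    using assoc_natural'[of "\<iota> ?I" "\<l> X" "\<iota> Y"] by simp
  finally have "((\<iota> ?I \<otimes> (\<l> (X \<boxtimes> Y) \<cdot> \<alpha> ?I X Y)) \<cdot> \<alpha> ?I (?I \<boxtimes> X) Y) \<cdot> (\<alpha> ?I ?I X \<otimes> \<iota> Y)
     = ((\<iota> ?I \<otimes> (\<l> X \<otimes> \<iota> Y)) \<cdot> \<alpha> ?I (?I \<boxtimes> X) Y) \<cdot> (\<alpha> ?I ?I X \<otimes> \<iota> Y)"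
    by simp
  moreover have "iso C (\<alpha> ?I ?I X \<otimes> \<iota> Y)"
    unfolding iso_def inverse_arrs_def
    by (rule exI[of _ "inv_arr C (\<alpha> ?I ?I X) \<otimes> \<iota> Y"])
       (simp add: hom_def inv_arr[OF assoc_iso[of ?I ?I X]])
  ultimately have "(\<iota> ?I \<otimes> (\<l> (X \<boxtimes> Y) \<cdot> \<alpha> ?I X Y)) \<cdot> \<alpha> ?I (?I \<boxtimes> X) Y
     = (\<iota> ?I \<otimes> (\<l> X \<otimes> \<iota> Y)) \<cdot> \<alpha> ?I (?I \<boxtimes> X) Y"
    by - (rule iso_cancel_right[of "\<alpha> ?I ?I X \<otimes> \<iota> Y"], simp_all)
  then have "\<iota> ?I \<otimes> (\<l> (X \<boxtimes> Y) \<cdot> \<alpha> ?I X Y) = \<iota> ?I \<otimes> (\<l> X \<otimes> \<iota> Y)"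
    by - (rule iso_cancel_right[OF assoc_iso[of ?I "?I \<boxtimes> X" Y]], simp_all)
  then show ?thesis
    by - (rule tens_unit_faithful(2), simp_all)
qed

lemma swap_natural':
  assumes "f \<in> Arr C" "g \<in> Arr C"
  shows "\<sigma> (Cod C f) (Cod C g) \<cdot> (f \<otimes> g) = (g \<otimes> f) \<cdot> \<sigma> (Dom C f) (Dom C g)"
  by (rule swap_natural) (use assms in \<open>auto simp: hom_def\<close>)

text \<open>The hexagon for \<open>X, I, I\<close>, followed by \<open>\<l>\<close>.\<close>

lemma lunit_swap:
  assumes [simp]: "X \<in> Ob C"
  shows "\<l> X \<cdot> \<sigma> X (unit C) = \<r> X"
proof -
  let ?I = "unit C"
  have "\<sigma> X ?I \<cdot> (\<r> X \<otimes> \<iota> ?I) = \<sigma> X ?I \<cdot> (\<iota> X \<otimes> \<l> ?I) \<cdot> \<alpha> X ?I ?I"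
    using triangle[of X ?I] by simp
  also have "\<dots> = (\<sigma> X ?I \<cdot> (\<iota> X \<otimes> \<l> ?I)) \<cdot> \<alpha> X ?I ?I"
    by simp
  also have "\<dots> = (\<l> ?I \<otimes> \<iota> X) \<cdot> \<sigma> X (?I \<boxtimes> ?I) \<cdot> \<alpha> X ?I ?I"
    using swap_natural'[of "\<iota> X" "\<l> ?I"] by simp
  also have "\<dots> = \<l> (?I \<boxtimes> X) \<cdot> \<alpha> ?I ?I X \<cdot> \<sigma> X (?I \<boxtimes> ?I) \<cdot> \<alpha> X ?I ?I"
    by (simp flip: lunit_tens)
  also have "\<dots> = (\<l> (?I \<boxtimes> X) \<cdot> (\<iota> ?I \<otimes> \<sigma> X ?I)) \<cdot> \<alpha> ?I X ?I \<cdot> (\<sigma> X ?I \<otimes> \<iota> ?I)"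
    by (simp add: hexagon)
  also have "\<dots> = \<sigma> X ?I \<cdot> (\<l> (X \<boxtimes> ?I) \<cdot> \<alpha> ?I X ?I) \<cdot> (\<sigma> X ?I \<otimes> \<iota> ?I)"
    using lunit_natural[OF homI, of "\<sigma> X ?I"] by simp
  also have "\<dots> = \<sigma> X ?I \<cdot> ((\<l> X \<cdot> \<sigma> X ?I) \<otimes> \<iota> ?I)"
    by (simp add: lunit_tens del: comp_assoc')
  finally have "\<r> X \<otimes> \<iota> ?I = (\<l> X \<cdot> \<sigma> X ?I) \<otimes> \<iota> ?I"
    by (rule_tac iso_cancel_left[of "\<sigma> X ?I"])
       (auto simp: iso_def inverse_arrs_def hom_def swap_swap intro!: exI[of _ "\<sigma> ?I X"])
  then show ?thesis
    by - (rule tens_unit_faithful(1), simp_all)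
qed

end

section \<open>Pairing\<close>

context markov_category
begin

text \<open>Almost all computations below take place among pairings \<open>\<langle>f, g\<rangle>\<close> of arrows with a common source.
  The structural isomorphisms act on pairings by permuting and rebracketing components, so that the
  simplifier proves equations between pairings without any appeal to coherence. In contrast to the
  cartesian case, the equation \<open>\<langle>a, b\<rangle> \<cdot> f = \<langle>a \<cdot> f, b \<cdot> f\<rangle>\<close> may fail; it is what
  determinism of \<open>f\<close> provides.\<close>

abbreviation pairing (\<open>\<langle>_,/ _\<rangle>\<close>) where "\<langle>f, g\<rangle> \<equiv> pair C f g"

abbreviation \<pi>\<^sub>1 where "\<pi>\<^sub>1 X Y \<equiv> proj1 C X Y"

definition \<pi>\<^sub>2 where "\<pi>\<^sub>2 X Y = \<l> Y \<cdot> (del C X \<otimes> \<iota> Y)"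

lemma copy_typing [simp]:
  assumes "X \<in> Ob C"
  shows "copy C X \<in> Arr C" "Dom C (copy C X) = X" "Cod C (copy C X) = X \<boxtimes> X"
  using copy_hom[OF assms] by (auto dest: homD)

lemma del_typing [simp]:
  assumes "X \<in> Ob C"
  shows "del C X \<in> Arr C" "Dom C (del C X) = X" "Cod C (del C X) = unit C"
  using del_hom[OF assms] by (auto dest: homD)

lemma proj_typing [simp]:
  assumes "X \<in> Ob C" "Y \<in> Ob C"
  shows "\<pi>\<^sub>1 X Y \<in> Arr C" "Dom C (\<pi>\<^sub>1 X Y) = X \<boxtimes> Y" "Cod C (\<pi>\<^sub>1 X Y) = X"
    and "\<pi>\<^sub>2 X Y \<in> Arr C" "Dom C (\<pi>\<^sub>2 X Y) = X \<boxtimes> Y" "Cod C (\<pi>\<^sub>2 X Y) = Y"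
  using assms by (simp_all add: proj1_def \<pi>\<^sub>2_def)

lemma pair_typing [simp]:
  assumes "f \<in> Arr C" "g \<in> Arr C" "Dom C f = Dom C g"
  shows "\<langle>f, g\<rangle> \<in> Arr C" "Dom C \<langle>f, g\<rangle> = Dom C g" "Cod C \<langle>f, g\<rangle> = Cod C f \<boxtimes> Cod C g"
  using assms by (simp_all add: pair_def)

lemma del_comp [simp]:
  assumes "f \<in> Arr C" "Cod C f = X"
  shows "del C X \<cdot> f = del C (Dom C f)"
proof -
  have "del C X \<cdot> f \<in> hom C (Dom C f) (unit C)" "del C (Dom C f) \<in> hom C (Dom C f) (unit C)"
    using assms by (auto simp: hom_def)
  then show ?thesis
    using unit_terminal[of "Dom C f"] assms by auto
qed

lemma tens_pair [simp]:
  assumes "f \<in> Arr C" "g \<in> Arr C" "Dom C f = Dom C g"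
    "a \<in> Arr C" "b \<in> Arr C" "Dom C a = Cod C f" "Dom C b = Cod C g"
  shows "(a \<otimes> b) \<cdot> \<langle>f, g\<rangle> = \<langle>a \<cdot> f, b \<cdot> g\<rangle>"
  using assms by (simp add: pair_def)

lemma tens_pair_extend [simp]:
  assumes "f \<in> Arr C" "g \<in> Arr C" "Dom C f = Dom C g" "x \<in> Arr C" "Cod C x = Dom C g"
    "a \<in> Arr C" "b \<in> Arr C" "Dom C a = Cod C f" "Dom C b = Cod C g"
  shows "(a \<otimes> b) \<cdot> \<langle>f, g\<rangle> \<cdot> x = \<langle>a \<cdot> f, b \<cdot> g\<rangle> \<cdot> x"
  by (rule comp_extend[OF tens_pair]) (use assms in auto)

lemma pair_ident: "X \<in> Ob C \<Longrightarrow> copy C X = \<langle>\<iota> X, \<iota> X\<rangle>"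
  by (simp add: pair_def)

text \<open>A pairing precomposed with \<open>f\<close> depends only on \<open>copy \<cdot> f\<close>, so rules about copying through \<open>f\<close> apply to it.\<close>

lemma pair_comp_copy:
  assumes "f \<in> Arr C" "a \<in> Arr C" "b \<in> Arr C" "Dom C a = Cod C f" "Dom C b = Cod C f"
  shows "\<langle>a, b\<rangle> \<cdot> f = (a \<otimes> b) \<cdot> copy C (Cod C f) \<cdot> f"
  using assms by (simp add: pair_def)

lemma assoc_pair [simp]:
  assumes "f \<in> Arr C" "g \<in> Arr C" "h \<in> Arr C" "Dom C f = Dom C g" "Dom C g = Dom C h"
    "X = Cod C f" "Y = Cod C g" "Z = Cod C h"
  shows "\<alpha> X Y Z \<cdot> \<langle>\<langle>f, g\<rangle>, h\<rangle> = \<langle>f, \<langle>g, h\<rangle>\<rangle>"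
proof -
  let ?W = "Dom C h"
  note [simp] = assms
  have "\<alpha> X Y Z \<cdot> \<langle>\<langle>f, g\<rangle>, h\<rangle>
      = (\<alpha> X Y Z \<cdot> ((f \<otimes> g) \<otimes> h)) \<cdot> (copy C ?W \<otimes> \<iota> ?W) \<cdot> copy C ?W"
    by (simp add: pair_def)
  also have "\<dots> = (f \<otimes> (g \<otimes> h)) \<cdot> \<alpha> ?W ?W ?W \<cdot> (copy C ?W \<otimes> \<iota> ?W) \<cdot> copy C ?W"
    using assoc_natural'[of f g h] by simp
  also have "\<dots> = \<langle>f, \<langle>g, h\<rangle>\<rangle>"
    by (simp add: copy_coassoc pair_def)
  finally show ?thesis .
qed

lemma assoc_pair_extend [simp]:
  assumes "f \<in> Arr C" "g \<in> Arr C" "h \<in> Arr C" "Dom C f = Dom C g" "Dom C g = Dom C h"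
    "x \<in> Arr C" "Cod C x = Dom C h" "X = Cod C f" "Y = Cod C g" "Z = Cod C h"
  shows "\<alpha> X Y Z \<cdot> \<langle>\<langle>f, g\<rangle>, h\<rangle> \<cdot> x = \<langle>f, \<langle>g, h\<rangle>\<rangle> \<cdot> x"
  by (rule comp_extend[OF assoc_pair]) (use assms in auto)

lemma pair_assoc_inverse:
  assumes "f \<in> Arr C" "g \<in> Arr C" "h \<in> Arr C" "Dom C f = Dom C g" "Dom C g = Dom C h"
    "x \<in> Arr C" "Cod C x = Dom C h" "X = Cod C f" "Y = Cod C g" "Z = Cod C h"
  shows "inv_arr C (\<alpha> X Y Z) \<cdot> \<langle>f, \<langle>g, h\<rangle>\<rangle> \<cdot> x = \<langle>\<langle>f, g\<rangle>, h\<rangle> \<cdot> x"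
proof -
  note [simp] = assms assoc_iso inv_arr[OF assoc_iso[of "Cod C f" "Cod C g" "Cod C h"]]
  have "inv_arr C (\<alpha> X Y Z) \<cdot> \<langle>f, \<langle>g, h\<rangle>\<rangle> \<cdot> x
      = inv_arr C (\<alpha> X Y Z) \<cdot> \<alpha> X Y Z \<cdot> \<langle>\<langle>f, g\<rangle>, h\<rangle> \<cdot> x"
    by simp
  also have "\<dots> = \<langle>\<langle>f, g\<rangle>, h\<rangle> \<cdot> x"
    by (subst comp_extend[OF inv_arr(5)]) simp_all
  finally show ?thesis .
qed

lemma swap_pair [simp]:
  assumes "f \<in> Arr C" "g \<in> Arr C" "Dom C f = Dom C g" "X = Cod C f" "Y = Cod C g"
  shows "\<sigma> X Y \<cdot> \<langle>f, g\<rangle> = \<langle>g, f\<rangle>"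
proof -
  note [simp] = assms
  have "\<sigma> X Y \<cdot> \<langle>f, g\<rangle> = (\<sigma> X Y \<cdot> (f \<otimes> g)) \<cdot> copy C (Dom C g)"
    by (simp add: pair_def)
  also have "\<dots> = \<langle>g, f\<rangle>"
    by (simp add: swap_natural' copy_cocomm pair_def)
  finally show ?thesis .
qed

lemma swap_pair_extend [simp]:
  assumes "f \<in> Arr C" "g \<in> Arr C" "Dom C f = Dom C g" "X = Cod C f" "Y = Cod C g"
    "x \<in> Arr C" "Cod C x = Dom C g"
  shows "\<sigma> X Y \<cdot> \<langle>f, g\<rangle> \<cdot> x = \<langle>g, f\<rangle> \<cdot> x"
  by (rule comp_extend[OF swap_pair]) (use assms in auto)

lemma proj_natural [simp]:
  assumes "f \<in> Arr C" "g \<in> Arr C" "X = Cod C f" "Y = Cod C g"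
  shows "\<pi>\<^sub>1 X Y \<cdot> (f \<otimes> g) = f \<cdot> \<pi>\<^sub>1 (Dom C f) (Dom C g)"
    and "\<pi>\<^sub>2 X Y \<cdot> (f \<otimes> g) = g \<cdot> \<pi>\<^sub>2 (Dom C f) (Dom C g)"
proof -
  note [simp] = assms
  have "\<pi>\<^sub>1 X Y \<cdot> (f \<otimes> g) = (\<r> X \<cdot> (f \<otimes> \<iota> (unit C))) \<cdot> (\<iota> (Dom C f) \<otimes> del C (Dom C g))"
    by (simp add: proj1_def)
  then show "\<pi>\<^sub>1 X Y \<cdot> (f \<otimes> g) = f \<cdot> \<pi>\<^sub>1 (Dom C f) (Dom C g)"
    using runit_natural[OF homI, of f] by (simp add: proj1_def)
  have "\<pi>\<^sub>2 X Y \<cdot> (f \<otimes> g) = (\<l> Y \<cdot> (\<iota> (unit C) \<otimes> g)) \<cdot> (del C (Dom C f) \<otimes> \<iota> (Dom C g))"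
    by (simp add: \<pi>\<^sub>2_def)
  then show "\<pi>\<^sub>2 X Y \<cdot> (f \<otimes> g) = g \<cdot> \<pi>\<^sub>2 (Dom C f) (Dom C g)"
    using lunit_natural[OF homI, of g] by (simp add: \<pi>\<^sub>2_def)
qed

lemma proj_pair [simp]:
  assumes "f \<in> Arr C" "g \<in> Arr C" "Dom C f = Dom C g" "X = Cod C f" "Y = Cod C g"
  shows "\<pi>\<^sub>1 X Y \<cdot> \<langle>f, g\<rangle> = f" and "\<pi>\<^sub>2 X Y \<cdot> \<langle>f, g\<rangle> = g"
proof -
  let ?W = "Dom C g"
  note [simp] = assms
  have "\<pi>\<^sub>1 X Y \<cdot> \<langle>f, g\<rangle> = (\<pi>\<^sub>1 X Y \<cdot> (f \<otimes> g)) \<cdot> copy C ?W"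
    by (simp add: pair_def del: proj_natural)
  also have "\<dots> = f \<cdot> \<pi>\<^sub>1 ?W ?W \<cdot> copy C ?W" by simp
  also have "\<pi>\<^sub>1 ?W ?W \<cdot> copy C ?W = \<iota> ?W" by (simp add: proj1_def copy_counit_right)
  finally show "\<pi>\<^sub>1 X Y \<cdot> \<langle>f, g\<rangle> = f" by simp
  have "\<pi>\<^sub>2 X Y \<cdot> \<langle>f, g\<rangle> = (\<pi>\<^sub>2 X Y \<cdot> (f \<otimes> g)) \<cdot> copy C ?W"
    by (simp add: pair_def del: proj_natural)
  also have "\<dots> = g \<cdot> \<pi>\<^sub>2 ?W ?W \<cdot> copy C ?W" by simp
  also have "\<pi>\<^sub>2 ?W ?W \<cdot> copy C ?W = \<iota> ?W" by (simp add: \<pi>\<^sub>2_def copy_counit_left)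
  finally show "\<pi>\<^sub>2 X Y \<cdot> \<langle>f, g\<rangle> = g" by simp
qed

lemma proj_pair_extend [simp]:
  assumes "f \<in> Arr C" "g \<in> Arr C" "Dom C f = Dom C g" "X = Cod C f" "Y = Cod C g"
    "x \<in> Arr C" "Cod C x = Dom C g"
  shows "\<pi>\<^sub>1 X Y \<cdot> \<langle>f, g\<rangle> \<cdot> x = f \<cdot> x" and "\<pi>\<^sub>2 X Y \<cdot> \<langle>f, g\<rangle> \<cdot> x = g \<cdot> x"
  by (rule comp_extend[OF proj_pair(1)]; use assms in simp)
     (rule comp_extend[OF proj_pair(2)]; use assms in simp)


section \<open>The projections are deterministic\<close>

text \<open>The triangle and the coherence laws for \<open>\<l>\<close> and \<open>\<r>\<close>, read as statements about discarding one of
  three factors.\<close>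

lemma proj_assoc:
  assumes [simp]: "X \<in> Ob C" "Y \<in> Ob C" "Z \<in> Ob C"
  shows "(\<iota> X \<otimes> \<pi>\<^sub>2 Y Z) \<cdot> \<alpha> X Y Z = \<pi>\<^sub>1 X Y \<otimes> \<iota> Z"
    and "\<pi>\<^sub>2 X (Y \<boxtimes> Z) \<cdot> \<alpha> X Y Z = \<pi>\<^sub>2 X Y \<otimes> \<iota> Z"
    and "(\<iota> X \<otimes> \<pi>\<^sub>1 Y Z) \<cdot> \<alpha> X Y Z = \<pi>\<^sub>1 (X \<boxtimes> Y) Z"
proof -
  let ?I = "unit C"
  have "(\<iota> X \<otimes> \<pi>\<^sub>2 Y Z) \<cdot> \<alpha> X Y Z
      = (\<iota> X \<otimes> \<l> Z) \<cdot> (\<iota> X \<otimes> (del C Y \<otimes> \<iota> Z)) \<cdot> \<alpha> X Y Z"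
    by (simp add: \<pi>\<^sub>2_def)
  also have "\<dots> = ((\<iota> X \<otimes> \<l> Z) \<cdot> \<alpha> X ?I Z) \<cdot> ((\<iota> X \<otimes> del C Y) \<otimes> \<iota> Z)"
    using assoc_natural'[of "\<iota> X" "del C Y" "\<iota> Z"] by simp
  also have "\<dots> = \<pi>\<^sub>1 X Y \<otimes> \<iota> Z"
    unfolding triangle[OF assms(1,3)] by (simp add: proj1_def)
  finally show "(\<iota> X \<otimes> \<pi>\<^sub>2 Y Z) \<cdot> \<alpha> X Y Z = \<pi>\<^sub>1 X Y \<otimes> \<iota> Z" .
  have "\<pi>\<^sub>2 X (Y \<boxtimes> Z) \<cdot> \<alpha> X Y Z
      = \<l> (Y \<boxtimes> Z) \<cdot> (del C X \<otimes> (\<iota> Y \<otimes> \<iota> Z)) \<cdot> \<alpha> X Y Z"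
    by (simp add: \<pi>\<^sub>2_def)
  also have "\<dots> = (\<l> (Y \<boxtimes> Z) \<cdot> \<alpha> ?I Y Z) \<cdot> ((del C X \<otimes> \<iota> Y) \<otimes> \<iota> Z)"
    using assoc_natural'[of "del C X" "\<iota> Y" "\<iota> Z"] by (simp del: tensM_ident)
  also have "\<dots> = \<pi>\<^sub>2 X Y \<otimes> \<iota> Z"
    unfolding lunit_tens[OF assms(2,3)] by (simp add: \<pi>\<^sub>2_def)
  finally show "\<pi>\<^sub>2 X (Y \<boxtimes> Z) \<cdot> \<alpha> X Y Z = \<pi>\<^sub>2 X Y \<otimes> \<iota> Z" .
  have "(\<iota> X \<otimes> \<pi>\<^sub>1 Y Z) \<cdot> \<alpha> X Y Z
      = (\<iota> X \<otimes> \<r> Y) \<cdot> (\<iota> X \<otimes> (\<iota> Y \<otimes> del C Z)) \<cdot> \<alpha> X Y Z"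
    by (simp add: proj1_def)
  also have "\<dots> = ((\<iota> X \<otimes> \<r> Y) \<cdot> \<alpha> X Y ?I) \<cdot> ((\<iota> X \<otimes> \<iota> Y) \<otimes> del C Z)"
    using assoc_natural'[of "\<iota> X" "\<iota> Y" "del C Z"] by simp
  also have "\<dots> = \<pi>\<^sub>1 (X \<boxtimes> Y) Z"
    unfolding runit_tens[OF assms(1,2)] by (simp add: proj1_def)
  finally show "(\<iota> X \<otimes> \<pi>\<^sub>1 Y Z) \<cdot> \<alpha> X Y Z = \<pi>\<^sub>1 (X \<boxtimes> Y) Z" .
qed

lemma proj_swap:
  assumes [simp]: "X \<in> Ob C" "Y \<in> Ob C"
  shows "\<pi>\<^sub>2 Y X \<cdot> \<sigma> X Y = \<pi>\<^sub>1 X Y" and "\<pi>\<^sub>1 Y X \<cdot> \<sigma> X Y = \<pi>\<^sub>2 X Y"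
proof -
  have *: "\<pi>\<^sub>2 B A \<cdot> \<sigma> A B = \<pi>\<^sub>1 A B" if [simp]: "A \<in> Ob C" "B \<in> Ob C" for A B
  proof -
    have "\<pi>\<^sub>2 B A \<cdot> \<sigma> A B = \<l> A \<cdot> (del C B \<otimes> \<iota> A) \<cdot> \<sigma> A B"
      by (simp add: \<pi>\<^sub>2_def)
    also have "\<dots> = (\<l> A \<cdot> \<sigma> A (unit C)) \<cdot> (\<iota> A \<otimes> del C B)"
      using swap_natural'[of "\<iota> A" "del C B"] by simp
    also have "\<dots> = \<pi>\<^sub>1 A B"
      unfolding lunit_swap[OF that(1)] by (simp add: proj1_def)
    finally show ?thesis .
  qed
  show "\<pi>\<^sub>2 Y X \<cdot> \<sigma> X Y = \<pi>\<^sub>1 X Y" by (simp add: *)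
  have "\<pi>\<^sub>1 Y X \<cdot> \<sigma> X Y = (\<pi>\<^sub>2 X Y \<cdot> \<sigma> Y X) \<cdot> \<sigma> X Y" by (simp only: * assms)
  also have "\<dots> = \<pi>\<^sub>2 X Y" by (simp add: swap_swap)
  finally show "\<pi>\<^sub>1 Y X \<cdot> \<sigma> X Y = \<pi>\<^sub>2 X Y" .
qed

text \<open>Copying on a product is componentwise copying followed by the middle swap, so the claim reduces to
  the effect of two projections on the middle swap. Its inner part \<open>M\<close> turns \<open>(x, (y, y'))\<close> into
  \<open>(y, (x, y'))\<close>; the equations \<open>M1\<close>, \<open>M2\<close>, \<open>M3\<close> below follow its components through the
  rebracketings.\<close>

lemma copy_proj:
  assumes [simp]: "X \<in> Ob C" "Y \<in> Ob C"
  shows "copy C X \<cdot> \<pi>\<^sub>1 X Y = \<langle>\<pi>\<^sub>1 X Y, \<pi>\<^sub>1 X Y\<rangle>"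
    and "copy C Y \<cdot> \<pi>\<^sub>2 X Y = \<langle>\<pi>\<^sub>2 X Y, \<pi>\<^sub>2 X Y\<rangle>"
    and "\<langle>\<pi>\<^sub>1 X Y, \<pi>\<^sub>2 X Y\<rangle> = \<iota> (X \<boxtimes> Y)"
proof -
  define \<alpha>' where "\<alpha>' U V W = inv_arr C (\<alpha> U V W)" for U V W
  have \<alpha>' [simp]: "\<alpha>' U V W \<in> Arr C" "Dom C (\<alpha>' U V W) = U \<boxtimes> (V \<boxtimes> W)"
      "Cod C (\<alpha>' U V W) = (U \<boxtimes> V) \<boxtimes> W" "\<alpha> U V W \<cdot> \<alpha>' U V W = \<iota> (U \<boxtimes> (V \<boxtimes> W))"
    if "U \<in> Ob C" "V \<in> Ob C" "W \<in> Ob C" for U V W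
    using inv_arr[OF assoc_iso[OF that]] that by (simp_all add: \<alpha>'_def)
  have proj_\<alpha>': "(\<pi>\<^sub>1 U V \<otimes> \<iota> W) \<cdot> \<alpha>' U V W = \<iota> U \<otimes> \<pi>\<^sub>2 V W"
      "(\<pi>\<^sub>2 U V \<otimes> \<iota> W) \<cdot> \<alpha>' U V W = \<pi>\<^sub>2 U (V \<boxtimes> W)"
    if [simp]: "U \<in> Ob C" "V \<in> Ob C" "W \<in> Ob C" for U V W
    by (simp_all flip: proj_assoc(1,2))
  define M where "M = \<alpha> Y X Y \<cdot> (\<sigma> X Y \<otimes> \<iota> Y) \<cdot> \<alpha>' X Y Y"
  have M [simp]: "M \<in> Arr C" "Dom C M = X \<boxtimes> (Y \<boxtimes> Y)" "Cod C M = Y \<boxtimes> (X \<boxtimes> Y)"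
    by (simp_all add: M_def)
  have ms: "copy C (X \<boxtimes> Y)
      = \<alpha>' X Y (X \<boxtimes> Y) \<cdot> (\<iota> X \<otimes> M) \<cdot> \<alpha> X X (Y \<boxtimes> Y) \<cdot> (copy C X \<otimes> copy C Y)"
    by (simp add: copy_tens middle_swap_def M_def \<alpha>'_def[symmetric])

  have "\<pi>\<^sub>1 X Y \<cdot> \<pi>\<^sub>2 Y (X \<boxtimes> Y) \<cdot> M
      = \<pi>\<^sub>1 X Y \<cdot> (\<pi>\<^sub>2 Y (X \<boxtimes> Y) \<cdot> \<alpha> Y X Y) \<cdot> (\<sigma> X Y \<otimes> \<iota> Y) \<cdot> \<alpha>' X Y Y"
    by (simp add: M_def)
  also have "\<dots> = \<pi>\<^sub>1 X Y \<cdot> (\<pi>\<^sub>1 X Y \<otimes> \<iota> Y) \<cdot> \<alpha>' X Y Y"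
    by (simp add: proj_assoc proj_swap del: proj_natural)
  also have "\<dots> = \<pi>\<^sub>1 X (Y \<boxtimes> Y)"
    by (simp add: proj_\<alpha>')
  finally have M1: "\<pi>\<^sub>1 X Y \<cdot> \<pi>\<^sub>2 Y (X \<boxtimes> Y) \<cdot> M = \<pi>\<^sub>1 X (Y \<boxtimes> Y)" .
  have "\<langle>\<pi>\<^sub>1 X Y, \<pi>\<^sub>1 X Y\<rangle> = (\<iota> X \<otimes> \<pi>\<^sub>1 X Y) \<cdot> (\<pi>\<^sub>1 X Y \<otimes> \<iota> (X \<boxtimes> Y)) \<cdot> copy C (X \<boxtimes> Y)"
    by (simp add: pair_def)
  also have "\<dots> = (\<iota> X \<otimes> \<pi>\<^sub>1 X Y) \<cdot> ((\<pi>\<^sub>1 X Y \<otimes> \<iota> (X \<boxtimes> Y)) \<cdot> \<alpha>' X Y (X \<boxtimes> Y))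
      \<cdot> (\<iota> X \<otimes> M) \<cdot> \<alpha> X X (Y \<boxtimes> Y) \<cdot> (copy C X \<otimes> copy C Y)"
    unfolding ms by simp
  also have "\<dots> = ((\<iota> X \<otimes> \<pi>\<^sub>1 X (Y \<boxtimes> Y)) \<cdot> \<alpha> X X (Y \<boxtimes> Y)) \<cdot> (copy C X \<otimes> copy C Y)"
    by (simp add: proj_\<alpha>' M1)
  also have "\<dots> = copy C X \<cdot> \<pi>\<^sub>1 X Y"
    unfolding proj_assoc(3)[OF assms(1,1) tensO_Ob[OF assms(2,2)]] by simp
  finally show "copy C X \<cdot> \<pi>\<^sub>1 X Y = \<langle>\<pi>\<^sub>1 X Y, \<pi>\<^sub>1 X Y\<rangle>" ..

  have "\<pi>\<^sub>2 X Y \<cdot> \<pi>\<^sub>2 Y (X \<boxtimes> Y) \<cdot> M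
      = \<pi>\<^sub>2 X Y \<cdot> (\<pi>\<^sub>2 Y (X \<boxtimes> Y) \<cdot> \<alpha> Y X Y) \<cdot> (\<sigma> X Y \<otimes> \<iota> Y) \<cdot> \<alpha>' X Y Y"
    by (simp add: M_def)
  also have "\<dots> = \<pi>\<^sub>2 X Y \<cdot> (\<pi>\<^sub>1 X Y \<otimes> \<iota> Y) \<cdot> \<alpha>' X Y Y"
    by (simp add: proj_assoc proj_swap del: proj_natural)
  also have "\<dots> = \<pi>\<^sub>2 Y Y \<cdot> \<pi>\<^sub>2 X (Y \<boxtimes> Y)"
    by (simp add: proj_\<alpha>')
  finally have M3: "\<pi>\<^sub>2 X Y \<cdot> \<pi>\<^sub>2 Y (X \<boxtimes> Y) \<cdot> M = \<pi>\<^sub>2 Y Y \<cdot> \<pi>\<^sub>2 X (Y \<boxtimes> Y)" .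
  have "\<langle>\<pi>\<^sub>1 X Y, \<pi>\<^sub>2 X Y\<rangle> = (\<iota> X \<otimes> \<pi>\<^sub>2 X Y) \<cdot> (\<pi>\<^sub>1 X Y \<otimes> \<iota> (X \<boxtimes> Y)) \<cdot> copy C (X \<boxtimes> Y)"
    by (simp add: pair_def)
  also have "\<dots> = (\<iota> X \<otimes> \<pi>\<^sub>2 X Y) \<cdot> ((\<pi>\<^sub>1 X Y \<otimes> \<iota> (X \<boxtimes> Y)) \<cdot> \<alpha>' X Y (X \<boxtimes> Y))
      \<cdot> (\<iota> X \<otimes> M) \<cdot> \<alpha> X X (Y \<boxtimes> Y) \<cdot> (copy C X \<otimes> copy C Y)"
    unfolding ms by simp
  also have "\<dots> = (\<iota> X \<otimes> \<pi>\<^sub>2 Y Y) \<cdot> ((\<iota> X \<otimes> \<pi>\<^sub>2 X (Y \<boxtimes> Y)) \<cdot> \<alpha> X X (Y \<boxtimes> Y)) \<cdot> (copy C X \<otimes> copy C Y)"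
    by (simp add: proj_\<alpha>' M3)
  also have "\<dots> = (\<pi>\<^sub>1 X X \<cdot> copy C X) \<otimes> (\<pi>\<^sub>2 Y Y \<cdot> copy C Y)"
    unfolding proj_assoc(1)[OF assms(1,1) tensO_Ob[OF assms(2,2)]] by simp
  also have "\<dots> = \<iota> (X \<boxtimes> Y)"
    by (simp add: pair_ident)
  finally show "\<langle>\<pi>\<^sub>1 X Y, \<pi>\<^sub>2 X Y\<rangle> = \<iota> (X \<boxtimes> Y)" .

  have "(\<iota> Y \<otimes> \<pi>\<^sub>2 X Y) \<cdot> M
      = ((\<iota> Y \<otimes> \<pi>\<^sub>2 X Y) \<cdot> \<alpha> Y X Y) \<cdot> (\<sigma> X Y \<otimes> \<iota> Y) \<cdot> \<alpha>' X Y Y"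
    by (simp add: M_def)
  also have "\<dots> = (\<pi>\<^sub>2 X Y \<otimes> \<iota> Y) \<cdot> \<alpha>' X Y Y"
    unfolding proj_assoc(1)[OF assms(2,1,2)] by (simp add: proj_swap)
  also have "\<dots> = \<pi>\<^sub>2 X (Y \<boxtimes> Y)"
    by (simp add: proj_\<alpha>')
  finally have M2: "(\<iota> Y \<otimes> \<pi>\<^sub>2 X Y) \<cdot> M = \<pi>\<^sub>2 X (Y \<boxtimes> Y)" .
  have "\<langle>\<pi>\<^sub>2 X Y, \<pi>\<^sub>2 X Y\<rangle> = (\<iota> Y \<otimes> \<pi>\<^sub>2 X Y) \<cdot> (\<pi>\<^sub>2 X Y \<otimes> \<iota> (X \<boxtimes> Y)) \<cdot> copy C (X \<boxtimes> Y)"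
    by (simp add: pair_def)
  also have "\<dots> = (\<iota> Y \<otimes> \<pi>\<^sub>2 X Y) \<cdot> ((\<pi>\<^sub>2 X Y \<otimes> \<iota> (X \<boxtimes> Y)) \<cdot> \<alpha>' X Y (X \<boxtimes> Y))
      \<cdot> (\<iota> X \<otimes> M) \<cdot> \<alpha> X X (Y \<boxtimes> Y) \<cdot> (copy C X \<otimes> copy C Y)"
    unfolding ms by simp
  also have "\<dots> = (\<iota> Y \<otimes> \<pi>\<^sub>2 X Y) \<cdot> (\<pi>\<^sub>2 X (Y \<boxtimes> (X \<boxtimes> Y)) \<cdot> (\<iota> X \<otimes> M))
      \<cdot> \<alpha> X X (Y \<boxtimes> Y) \<cdot> (copy C X \<otimes> copy C Y)"
    unfolding proj_\<alpha>'(2)[OF assms tensO_Ob[OF assms]] by (simp del: proj_natural)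
  also have "\<pi>\<^sub>2 X (Y \<boxtimes> (X \<boxtimes> Y)) \<cdot> (\<iota> X \<otimes> M) = M \<cdot> \<pi>\<^sub>2 X (X \<boxtimes> (Y \<boxtimes> Y))"
    by simp
  also have "(\<iota> Y \<otimes> \<pi>\<^sub>2 X Y) \<cdot> (M \<cdot> \<pi>\<^sub>2 X (X \<boxtimes> (Y \<boxtimes> Y))) \<cdot> \<alpha> X X (Y \<boxtimes> Y) \<cdot> (copy C X \<otimes> copy C Y)
      = ((\<iota> Y \<otimes> \<pi>\<^sub>2 X Y) \<cdot> M)
      \<cdot> (\<pi>\<^sub>2 X (X \<boxtimes> (Y \<boxtimes> Y)) \<cdot> \<alpha> X X (Y \<boxtimes> Y)) \<cdot> (copy C X \<otimes> copy C Y)"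
    by simp
  also have "\<dots> = (\<pi>\<^sub>2 X (Y \<boxtimes> Y) \<cdot> (\<pi>\<^sub>2 X X \<otimes> \<iota> (Y \<boxtimes> Y))) \<cdot> (copy C X \<otimes> copy C Y)"
    unfolding M2 proj_assoc(2)[OF assms(1,1) tensO_Ob[OF assms(2,2)]] by (simp del: proj_natural)
  also have "\<pi>\<^sub>2 X (Y \<boxtimes> Y) \<cdot> (\<pi>\<^sub>2 X X \<otimes> \<iota> (Y \<boxtimes> Y)) = \<pi>\<^sub>2 (X \<boxtimes> X) (Y \<boxtimes> Y)"
    by simp
  also have "\<pi>\<^sub>2 (X \<boxtimes> X) (Y \<boxtimes> Y) \<cdot> (copy C X \<otimes> copy C Y) = copy C Y \<cdot> \<pi>\<^sub>2 X Y"
    by simp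
  finally show "copy C Y \<cdot> \<pi>\<^sub>2 X Y = \<langle>\<pi>\<^sub>2 X Y, \<pi>\<^sub>2 X Y\<rangle>" ..
qed

lemma pair_comp_proj [simp]:
  assumes "a \<in> Arr C" "b \<in> Arr C" "Dom C a = Dom C b" "Y \<in> Ob C"
  shows "Dom C b = X \<Longrightarrow> \<langle>a, b\<rangle> \<cdot> \<pi>\<^sub>1 X Y = \<langle>a \<cdot> \<pi>\<^sub>1 X Y, b \<cdot> \<pi>\<^sub>1 X Y\<rangle>"
    and "Dom C b = X \<Longrightarrow> \<langle>a, b\<rangle> \<cdot> \<pi>\<^sub>2 Y X = \<langle>a \<cdot> \<pi>\<^sub>2 Y X, b \<cdot> \<pi>\<^sub>2 Y X\<rangle>"
  using assms by (auto simp: pair_comp_copy copy_proj)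

end

section \<open>Disintegration and almost sure equality\<close>

locale markov_category_with_conditionals = markov_category C
  for C :: "('o, 'm, 'z) markov_scheme" (structure) +
  assumes conditionals: "has_conditionals C"
begin

text \<open>The conditional of a state on \<open>X \<boxtimes> Y\<close> is an arrow \<open>X \<boxtimes> I \<rightarrow> Y\<close>. Precomposing it with \<open>\<langle>id, del\<rangle>\<close>, the
  inverse of \<open>\<r>\<close>, gives a kernel \<open>X \<rightarrow> Y\<close>, and the spare unit wire in the definition of
  conditionals disappears.\<close>

lemma disintegration:
  assumes homs: "p \<in> hom C (unit C) \<Omega>" "f \<in> hom C \<Omega> X" "g \<in> hom C \<Omega> Y"
  obtains c where "c \<in> hom C X Y" "\<langle>f, g\<rangle> \<cdot> p = \<langle>\<iota> X, c\<rangle> \<cdot> f \<cdot> p"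
proof -
  let ?I = "unit C"
  note [simp] = homs[THEN homD]
  have "\<langle>f, g\<rangle> \<cdot> p \<in> hom C ?I (X \<boxtimes> Y)" by (simp add: hom_def)
  then obtain c where c: "c \<in> hom C (X \<boxtimes> ?I) Y"
    "\<langle>f, g\<rangle> \<cdot> p = (\<iota> X \<otimes> c) \<cdot> \<alpha> X X ?I \<cdot> (copy C X \<otimes> \<iota> ?I)
       \<cdot> ((\<pi>\<^sub>1 X Y \<cdot> \<langle>f, g\<rangle> \<cdot> p) \<otimes> \<iota> ?I) \<cdot> copy C ?I"
    using conditionals unfolding has_conditionals_def by (metis homD unit_Ob homs(2,3))
  note [simp] = c(1)[THEN homD]
  have \<r>: "\<r> W \<cdot> \<langle>\<iota> W, del C W\<rangle> = \<iota> W" if "W \<in> Ob C" for W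
    using that by (simp add: pair_def copy_counit_right)
  have unit: "\<langle>\<iota> X, del C X\<rangle> \<cdot> x = \<langle>x, \<iota> ?I\<rangle>" if x: "x \<in> hom C ?I X" for x
  proof -
    note [simp] = homD[OF x]
    have "\<r> X \<cdot> \<langle>x, \<iota> ?I\<rangle> = (\<r> X \<cdot> (x \<otimes> \<iota> ?I)) \<cdot> copy C ?I"
      by (simp add: pair_def)
    also have "\<dots> = x \<cdot> \<r> ?I \<cdot> (\<iota> ?I \<otimes> del C ?I) \<cdot> copy C ?I"
      by (simp add: runit_natural[OF x] del_unit)
    also have "\<dots> = x" by (subst copy_counit_right) simp_all
    finally have "\<r> X \<cdot> \<langle>x, \<iota> ?I\<rangle> = \<r> X \<cdot> \<langle>\<iota> X, del C X\<rangle> \<cdot> x"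
      by (simp add: comp_extend[OF \<r>])
    then show ?thesis
      by - (rule iso_cancel_left[OF runit_iso[of X]], simp_all)
  qed
  have "\<langle>f, g\<rangle> \<cdot> p = (\<iota> X \<otimes> c) \<cdot> \<alpha> X X ?I \<cdot> (copy C X \<otimes> \<iota> ?I) \<cdot> \<langle>f \<cdot> p, \<iota> ?I\<rangle>"
    using c(2) by (simp add: pair_def[of C "f \<cdot> p" "\<iota> ?I"])
  also have "\<langle>f \<cdot> p, \<iota> ?I\<rangle> = \<langle>\<iota> X, del C X\<rangle> \<cdot> f \<cdot> p"
    by (rule unit[symmetric]) (simp add: hom_def)
  also have "(\<iota> X \<otimes> c) \<cdot> \<alpha> X X ?I \<cdot> (copy C X \<otimes> \<iota> ?I) \<cdot> \<langle>\<iota> X, del C X\<rangle> \<cdot> f \<cdot> p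
      = \<langle>\<iota> X, c \<cdot> \<langle>\<iota> X, del C X\<rangle>\<rangle> \<cdot> f \<cdot> p"
    by (simp add: pair_ident)
  finally show ?thesis
    by (rule that[rotated]) (simp add: hom_def)
qed

text \<open>The identity in the definition of almost sure equality may be replaced by any other variable
  \<open>a\<close>, since \<open>\<langle>a, f\<rangle>\<close> is obtained from \<open>\<langle>id, f\<rangle>\<close> by applying \<open>a\<close> to the first component.\<close>

lemma as_eqD:
  assumes homs: "p \<in> hom C A \<Omega>" "f \<in> hom C \<Omega> X" "g \<in> hom C \<Omega> X" "a \<in> hom C \<Omega> Y"
    and "as_eq C p f g"
  shows "\<langle>a, f\<rangle> \<cdot> p = \<langle>a, g\<rangle> \<cdot> p"
proof -
  note [simp] = homs[THEN homD]
  have "(a \<otimes> \<iota> X) \<cdot> \<langle>\<iota> \<Omega>, f\<rangle> \<cdot> p = (a \<otimes> \<iota> X) \<cdot> \<langle>\<iota> \<Omega>, g\<rangle> \<cdot> p"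
    using assms(5) by (simp add: as_eq_def)
  then show ?thesis by simp
qed

lemma as_eq_refl: "as_eq C p f f"
  by (simp add: as_eq_def)

lemma as_eq_sym: "as_eq C p f g \<Longrightarrow> as_eq C p g f"
  by (simp add: as_eq_def)

lemma as_eq_trans [trans]: "\<lbrakk>as_eq C p f g; as_eq C p g h\<rbrakk> \<Longrightarrow> as_eq C p f h"
  by (simp add: as_eq_def)

lemma as_eq_state:
  assumes homs: "p \<in> hom C A \<Omega>" "f \<in> hom C \<Omega> X" "g \<in> hom C \<Omega> X"
    and "as_eq C p f g"
  shows "f \<cdot> p = g \<cdot> p"
proof -
  note [simp] = homs[THEN homD]
  have "\<pi>\<^sub>2 \<Omega> X \<cdot> \<langle>\<iota> \<Omega>, f\<rangle> \<cdot> p = \<pi>\<^sub>2 \<Omega> X \<cdot> \<langle>\<iota> \<Omega>, g\<rangle> \<cdot> p"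
    using assms(4) by (simp add: as_eq_def)
  then show ?thesis by simp
qed

lemma as_eq_post:
  assumes homs: "p \<in> hom C A \<Omega>" "f \<in> hom C \<Omega> X" "g \<in> hom C \<Omega> X" "h \<in> hom C X Y"
    and "as_eq C p f g"
  shows "as_eq C p (h \<cdot> f) (h \<cdot> g)"
proof -
  note [simp] = homs[THEN homD]
  have "(\<iota> \<Omega> \<otimes> h) \<cdot> \<langle>\<iota> \<Omega>, f\<rangle> \<cdot> p = (\<iota> \<Omega> \<otimes> h) \<cdot> \<langle>\<iota> \<Omega>, g\<rangle> \<cdot> p"
    using assms(5) by (simp add: as_eq_def)
  then show ?thesis by (simp add: as_eq_def)
qed

lemma as_eq_pair_left:
  assumes homs: "p \<in> hom C A \<Omega>" "f \<in> hom C \<Omega> X" "g \<in> hom C \<Omega> X" "a \<in> hom C \<Omega> Y"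
    and "as_eq C p f g"
  shows "as_eq C p \<langle>a, f\<rangle> \<langle>a, g\<rangle>"
proof -
  note [simp] = homs[THEN homD]
  have "\<alpha> \<Omega> Y X \<cdot> \<langle>\<langle>\<iota> \<Omega>, a\<rangle>, f\<rangle> \<cdot> p = \<alpha> \<Omega> Y X \<cdot> \<langle>\<langle>\<iota> \<Omega>, a\<rangle>, g\<rangle> \<cdot> p"
    by (subst as_eqD[OF homs(1-3) _ assms(5)]) (auto simp: hom_def)
  then show ?thesis by (simp add: as_eq_def)
qed

lemma as_eq_pair_right:
  assumes homs: "p \<in> hom C A \<Omega>" "f \<in> hom C \<Omega> X" "g \<in> hom C \<Omega> X" "a \<in> hom C \<Omega> Y"
    and "as_eq C p f g"
  shows "as_eq C p \<langle>f, a\<rangle> \<langle>g, a\<rangle>"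
proof -
  note [simp] = homs[THEN homD]
  have "as_eq C p (\<sigma> Y X \<cdot> \<langle>a, f\<rangle>) (\<sigma> Y X \<cdot> \<langle>a, g\<rangle>)"
    by (rule as_eq_post[OF homs(1) _ _ _ as_eq_pair_left[OF assms]]) (auto simp: hom_def)
  then show ?thesis by simp
qed

lemma as_eq_pair:
  assumes homs: "p \<in> hom C A \<Omega>" "f \<in> hom C \<Omega> X" "f' \<in> hom C \<Omega> X" "g \<in> hom C \<Omega> Y" "g' \<in> hom C \<Omega> Y"
    and "as_eq C p f f'" "as_eq C p g g'"
  shows "as_eq C p \<langle>f, g\<rangle> \<langle>f', g'\<rangle>"
  using as_eq_pair_right[OF homs(1-4) assms(6)] as_eq_pair_left[OF homs(1,4,5,3) assms(7)]
  by (rule as_eq_trans)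

text \<open>Precomposition needs a disintegration \<open>c\<close> of \<open>p\<close> along \<open>m\<close>: both \<open>\<langle>id, f m\<rangle> p\<close> and
  \<open>\<langle>id, g m\<rangle> p\<close> arise by applying \<open>c\<close> to the first factor of a law that depends only on the
  almost sure class of \<open>f\<close>, resp. \<open>g\<close>.\<close>

lemma as_eq_pre:
  assumes homs: "p \<in> hom C (unit C) \<Omega>" "m \<in> hom C \<Omega> X" "f \<in> hom C X Y" "g \<in> hom C X Y"
    and "as_eq C (m \<cdot> p) f g"
  shows "as_eq C p (f \<cdot> m) (g \<cdot> m)"
proof -
  note [simp] = homs[THEN homD]
  obtain c where c: "c \<in> hom C X \<Omega>" "\<langle>m, \<iota> \<Omega>\<rangle> \<cdot> p = \<langle>\<iota> X, c\<rangle> \<cdot> m \<cdot> p"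
    by (rule disintegration[OF homs(1,2), of "\<iota> \<Omega>" \<Omega>]) (auto simp: hom_def)
  note [simp] = c(1)[THEN homD]
  have *: "\<langle>\<iota> \<Omega>, h \<cdot> m\<rangle> \<cdot> p = (c \<otimes> \<iota> Y) \<cdot> \<langle>\<iota> X, h\<rangle> \<cdot> m \<cdot> p" if h: "h \<in> hom C X Y" for h
  proof -
    note [simp] = h[THEN homD]
    have "\<langle>\<iota> \<Omega>, h \<cdot> m\<rangle> \<cdot> p = \<sigma> Y \<Omega> \<cdot> (h \<otimes> \<iota> \<Omega>) \<cdot> \<langle>m, \<iota> \<Omega>\<rangle> \<cdot> p" by simp
    also have "\<dots> = (c \<otimes> \<iota> Y) \<cdot> \<langle>\<iota> X, h\<rangle> \<cdot> m \<cdot> p" unfolding c(2) by simp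
    finally show ?thesis .
  qed
  have "\<langle>\<iota> X, f\<rangle> \<cdot> m \<cdot> p = \<langle>\<iota> X, g\<rangle> \<cdot> m \<cdot> p"
    using assms(5) by (simp add: as_eq_def)
  then show ?thesis using *[OF homs(3)] *[OF homs(4)] by (simp add: as_eq_def)
qed

lemma as_eq_comp:
  assumes homs: "p \<in> hom C (unit C) \<Omega>" "f \<in> hom C \<Omega> X" "f' \<in> hom C \<Omega> X" "g \<in> hom C X Y" "g' \<in> hom C X Y"
    and "as_eq C p f f'" "as_eq C (f \<cdot> p) g g'"
  shows "as_eq C p (g \<cdot> f) (g' \<cdot> f')"
  using as_eq_pre[OF homs(1,2,4,5) assms(7)] as_eq_post[OF homs(1-3,5) assms(6)]
  by (rule as_eq_trans)


text \<open>Almost sure equality is visible in the joint law of \<open>f\<close> and \<open>g\<close> alone. Disintegrate the law of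
  \<open>\<langle>f, \<langle>g, id\<rangle>\<rangle>\<close> over \<open>f\<close> into a kernel \<open>c\<close>. As the joint law is diagonal, the first marginal of \<open>c\<close> is
  almost surely the identity, hence conditioning \<open>c\<close> on its first component shows that \<open>c\<close> almost
  surely has the form \<open>\<langle>id, e\<rangle>\<close>. So \<open>f\<close> and \<open>g\<close> are interchangeable in the law of
  \<open>\<langle>f, \<langle>g, id\<rangle>\<rangle>\<close>, and forgetting either of them gives the claim.\<close>

lemma as_eq_if_diagonal:
  assumes homs: "p \<in> hom C (unit C) \<Omega>" "f \<in> hom C \<Omega> X" "g \<in> hom C \<Omega> X"
    and diagonal: "\<langle>f, g\<rangle> \<cdot> p = copy C X \<cdot> f \<cdot> p"
  shows "as_eq C p f g"
proof -
  note [simp] = homs[THEN homD]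
  obtain c where c: "c \<in> hom C X (X \<boxtimes> \<Omega>)" "\<langle>f, \<langle>g, \<iota> \<Omega>\<rangle>\<rangle> \<cdot> p = \<langle>\<iota> X, c\<rangle> \<cdot> f \<cdot> p"
    by (rule disintegration[OF homs(1,2), of "\<langle>g, \<iota> \<Omega>\<rangle>" "X \<boxtimes> \<Omega>"]) (auto simp: hom_def)
  note [simp] = c(1)[THEN homD]
  obtain c' where c': "c' \<in> hom C (X \<boxtimes> X) \<Omega>"
    "c = (\<iota> X \<otimes> c') \<cdot> \<alpha> X X X \<cdot> (copy C X \<otimes> \<iota> X) \<cdot> ((\<pi>\<^sub>1 X \<Omega> \<cdot> c) \<otimes> \<iota> X) \<cdot> copy C X"
    using conditionals c(1) unfolding has_conditionals_def by (metis homD homs(2))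
  note [simp] = c'(1)[THEN homD]
  let ?H = "(\<iota> X \<otimes> c') \<cdot> \<alpha> X X X \<cdot> (copy C X \<otimes> \<iota> X)"
  have c_eq: "c = ?H \<cdot> \<langle>\<pi>\<^sub>1 X \<Omega> \<cdot> c, \<iota> X\<rangle>"
    by (subst c'(2)) (simp add: pair_def)
  have fp: "f \<cdot> p \<in> hom C (unit C) X" by (simp add: hom_def)
  have "\<langle>\<iota> X, \<pi>\<^sub>1 X \<Omega> \<cdot> c\<rangle> \<cdot> f \<cdot> p = (\<iota> X \<otimes> \<pi>\<^sub>1 X \<Omega>) \<cdot> \<langle>f, \<langle>g, \<iota> \<Omega>\<rangle>\<rangle> \<cdot> p"
    unfolding c(2) by simp
  also have "\<dots> = \<langle>\<iota> X, \<iota> X\<rangle> \<cdot> f \<cdot> p"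
    using diagonal by (simp add: pair_ident)
  finally have "as_eq C (f \<cdot> p) (\<pi>\<^sub>1 X \<Omega> \<cdot> c) (\<iota> X)"
    by (simp add: as_eq_def)
  then have "as_eq C (f \<cdot> p) \<langle>\<pi>\<^sub>1 X \<Omega> \<cdot> c, \<iota> X\<rangle> \<langle>\<iota> X, \<iota> X\<rangle>"
    by (rule as_eq_pair_right[OF fp, rotated 3]) (auto simp: hom_def)
  then have "as_eq C (f \<cdot> p) (?H \<cdot> \<langle>\<pi>\<^sub>1 X \<Omega> \<cdot> c, \<iota> X\<rangle>) (?H \<cdot> \<langle>\<iota> X, \<iota> X\<rangle>)"
    by (rule as_eq_post[OF fp, rotated 3]) (auto simp: hom_def)
  moreover have "?H \<cdot> \<langle>\<iota> X, \<iota> X\<rangle> = \<langle>\<iota> X, c' \<cdot> \<langle>\<iota> X, \<iota> X\<rangle>\<rangle>"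
    by (simp add: pair_ident)
  ultimately have "as_eq C (f \<cdot> p) c \<langle>\<iota> X, c' \<cdot> \<langle>\<iota> X, \<iota> X\<rangle>\<rangle>"
    using c_eq by simp
  then have law: "\<langle>f, \<langle>g, \<iota> \<Omega>\<rangle>\<rangle> \<cdot> p = \<langle>\<iota> X, \<langle>\<iota> X, c' \<cdot> \<langle>\<iota> X, \<iota> X\<rangle>\<rangle>\<rangle> \<cdot> f \<cdot> p"
    using c(2) by (simp add: as_eq_def)
  have "\<langle>f, \<iota> \<Omega>\<rangle> \<cdot> p = (\<iota> X \<otimes> \<pi>\<^sub>2 X \<Omega>) \<cdot> \<langle>f, \<langle>g, \<iota> \<Omega>\<rangle>\<rangle> \<cdot> p" by simp
  also have "\<dots> = \<pi>\<^sub>2 X (X \<boxtimes> \<Omega>) \<cdot> \<langle>f, \<langle>g, \<iota> \<Omega>\<rangle>\<rangle> \<cdot> p" unfolding law by simp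
  also have "\<dots> = \<langle>g, \<iota> \<Omega>\<rangle> \<cdot> p" by simp
  finally have "\<sigma> X \<Omega> \<cdot> \<langle>f, \<iota> \<Omega>\<rangle> \<cdot> p = \<sigma> X \<Omega> \<cdot> \<langle>g, \<iota> \<Omega>\<rangle> \<cdot> p" by simp
  then show ?thesis by (simp add: as_eq_def)
qed


section \<open>Almost surely deterministic morphisms\<close>

text \<open>This is the form in which determinism is used: a deterministic \<open>f\<close> may be moved into a pairing.\<close>

lemma as_deterministic_pair:
  assumes homs: "p \<in> hom C A \<Omega>" "f \<in> hom C \<Omega> X" "a \<in> hom C X Y" "b \<in> hom C X Z"
    and "as_deterministic C p f"
  shows "as_eq C p (\<langle>a, b\<rangle> \<cdot> f) \<langle>a \<cdot> f, b \<cdot> f\<rangle>"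
proof -
  note [simp] = homs[THEN homD]
  have "as_eq C p (copy C X \<cdot> f) \<langle>f, f\<rangle>"
    using assms(5) by (simp add: as_deterministic_def pair_def)
  then have "as_eq C p ((a \<otimes> b) \<cdot> copy C X \<cdot> f) ((a \<otimes> b) \<cdot> \<langle>f, f\<rangle>)"
    by (rule as_eq_post[OF homs(1), rotated 3]) (auto simp: hom_def)
  then show ?thesis by (simp add: pair_ident)
qed

lemma as_deterministicI:
  assumes "f \<in> hom C \<Omega> X" "as_eq C p (copy C X \<cdot> f) \<langle>f, f\<rangle>"
  shows "as_deterministic C p f"
  using assms by (auto simp: as_deterministic_def pair_def dest: homD)

lemma as_deterministic_copy:
  assumes homs: "p \<in> hom C A \<Omega>" "f \<in> hom C \<Omega> X"
    and "as_deterministic C p f"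
  shows "as_eq C p (copy C X \<cdot> f) \<langle>f, f\<rangle>"
  using assms by (auto simp: as_deterministic_def pair_def dest: homD)

lemma as_deterministic_cong:
  assumes homs: "p \<in> hom C A \<Omega>" "f \<in> hom C \<Omega> X" "f' \<in> hom C \<Omega> X"
    and "as_deterministic C p f" "as_eq C p f f'"
  shows "as_deterministic C p f'"
proof (rule as_deterministicI[OF homs(3)])
  note [simp] = homs[THEN homD]
  have "as_eq C p (copy C X \<cdot> f') (copy C X \<cdot> f)"
    by (rule as_eq_post[OF homs(1,3,2) _ as_eq_sym[OF assms(5)]]) (simp add: hom_def)
  also have "as_eq C p \<dots> \<langle>f, f\<rangle>"
    by (rule as_deterministic_copy[OF homs(1,2) assms(4)])
  also have "as_eq C p \<dots> \<langle>f', f'\<rangle>"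
    by (rule as_eq_pair[OF homs(1) homs(2,3,2,3) assms(5,5)])
  finally show "as_eq C p (copy C X \<cdot> f') \<langle>f', f'\<rangle>" .
qed

lemma as_deterministic_comp:
  assumes homs: "p \<in> hom C (unit C) \<Omega>" "f \<in> hom C \<Omega> X" "g \<in> hom C X Y"
    and "as_deterministic C p f" "as_deterministic C (f \<cdot> p) g"
  shows "as_deterministic C p (g \<cdot> f)"
proof (rule as_deterministicI)
  note [simp] = homs[THEN homD]
  show "g \<cdot> f \<in> hom C \<Omega> Y" by (simp add: hom_def)
  have "as_eq C (f \<cdot> p) (copy C Y \<cdot> g) \<langle>g, g\<rangle>"
    by (rule as_deterministic_copy[OF _ homs(3) assms(5)]) (simp add: hom_def)
  then have "as_eq C p ((copy C Y \<cdot> g) \<cdot> f) (\<langle>g, g\<rangle> \<cdot> f)"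
    by (rule as_eq_pre[OF homs(1,2), rotated 2]) (auto simp: hom_def)
  then have "as_eq C p (copy C Y \<cdot> g \<cdot> f) (\<langle>g, g\<rangle> \<cdot> f)" by simp
  also have "as_eq C p \<dots> \<langle>g \<cdot> f, g \<cdot> f\<rangle>"
    by (rule as_deterministic_pair[OF homs(1,2,3,3) assms(4)])
  finally show "as_eq C p (copy C Y \<cdot> g \<cdot> f) \<langle>g \<cdot> f, g \<cdot> f\<rangle>" .
qed

lemma as_deterministic_proj:
  assumes "p \<in> Arr C" "X \<in> Ob C" "Y \<in> Ob C"
  shows "as_deterministic C p (\<pi>\<^sub>1 X Y)" "as_deterministic C p (\<pi>\<^sub>2 X Y)"
  by (rule as_deterministicI[of _ "X \<boxtimes> Y"], use assms in \<open>auto simp: hom_def copy_proj as_eq_refl\<close>)+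


section \<open>Sample spaces through representatives\<close>


text \<open>Arrows of \<open>Sample C\<close> are classes, while all the arguments are about representatives. The arrow
  represented by \<open>f\<close> is \<open>as_class S T f\<close>, which is meaningful when \<open>sample_map S T f\<close> holds; the lemmas
  of this section translate composition, equality and independence of classes.\<close>

definition sample_map :: "('o, 'm) space \<Rightarrow> ('o, 'm) space \<Rightarrow> 'm \<Rightarrow> bool" where
  "sample_map S T f \<longleftrightarrow> S \<in> prob_spaces C \<and> T \<in> prob_spaces C
     \<and> f \<in> state_preserving C S T \<and> as_deterministic C (snd S) f"

definition as_class :: "('o, 'm) space \<Rightarrow> ('o, 'm) space \<Rightarrow> 'm \<Rightarrow> ('o, 'm) space_arr" where
  "as_class S T f = (S, T, as_rel C S T `` {f})"

lemma Dom_as_class [simp]: "Dom (Sample C) (as_class S T f) = S"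
  by (simp add: as_class_def Sample_def Prob_def)

lemma sample_mapD:
  assumes "sample_map S T f"
  shows "f \<in> hom C (fst S) (fst T)" "snd S \<in> hom C (unit C) (fst S)"
    "snd T \<in> hom C (unit C) (fst T)" "f \<cdot> snd S = snd T" "as_deterministic C (snd S) f"
  using assms by (auto simp: sample_map_def state_preserving_def prob_spaces_def)

lemma sample_mapI:
  assumes "f \<in> hom C (fst S) (fst T)" "snd S \<in> hom C (unit C) (fst S)"
    "snd T \<in> hom C (unit C) (fst T)" "f \<cdot> snd S = snd T" "as_deterministic C (snd S) f"
  shows "sample_map S T f"
  using assms by (auto simp: sample_map_def state_preserving_def prob_spaces_def
      split: prod.split dest: homD)

lemma rep_as_class_iff:
  assumes "sample_map S T f"
  shows "f' \<in> rep (as_class S T f) \<longleftrightarrow> sample_map S T f' \<and> as_eq C (snd S) f f'"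
proof -
  note f = sample_mapD[OF assms]
  have "as_deterministic C (snd S) f'"
    if "f' \<in> hom C (fst S) (fst T)" "as_eq C (snd S) f f'"
    using as_deterministic_cong[OF f(2,1) that(1) f(5) that(2)] .
  then show ?thesis
    using assms by (auto simp: as_class_def as_rel_def sample_map_def state_preserving_def)
qed

lemma hom_Sample_iff: "F \<in> hom (Sample C) S T \<longleftrightarrow> (\<exists>f. sample_map S T f \<and> F = as_class S T f)"
proof
  assume F: "F \<in> hom (Sample C) S T"
  then obtain F\<^sub>0 where F\<^sub>0: "F = (S, T, F\<^sub>0)" "S \<in> prob_spaces C" "T \<in> prob_spaces C"
    "F\<^sub>0 \<in> state_preserving C S T // as_rel C S T" "\<forall>f\<in>F\<^sub>0. as_deterministic C (snd S) f"
    by (auto simp: hom_def Sample_def Prob_def)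
  from F\<^sub>0(4) obtain f where f: "f \<in> state_preserving C S T" "F\<^sub>0 = as_rel C S T `` {f}"
    by (rule quotientE)
  then have "f \<in> F\<^sub>0" by (auto simp: as_rel_def as_eq_refl)
  then show "\<exists>f. sample_map S T f \<and> F = as_class S T f"
    using F\<^sub>0 f by (auto simp: sample_map_def as_class_def)
next
  assume "\<exists>f. sample_map S T f \<and> F = as_class S T f"
  then obtain f where f: "sample_map S T f" "F = as_class S T f" by blast
  have "\<forall>f'\<in>rep (as_class S T f). as_deterministic C (snd S) f'"
    by (auto simp: rep_as_class_iff[OF f(1)] sample_mapD)
  then show "F \<in> hom (Sample C) S T"
    using f by (auto simp: hom_def Sample_def Prob_def as_class_def sample_map_def intro: quotientI)
qed

lemma as_class_eq_iff:
  assumes "sample_map S T f" "sample_map S T g"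
  shows "as_class S T f = as_class S T g \<longleftrightarrow> as_eq C (snd S) f g"
proof
  assume "as_class S T f = as_class S T g"
  moreover have "g \<in> rep (as_class S T g)"
    by (simp add: rep_as_class_iff[OF assms(2)] assms as_eq_refl)
  ultimately have "g \<in> rep (as_class S T f)" by simp
  then show "as_eq C (snd S) f g"
    by (simp add: rep_as_class_iff[OF assms(1)])
next
  assume fg: "as_eq C (snd S) f g"
  have "rep (as_class S T f) = rep (as_class S T g)"
    unfolding set_eq_iff rep_as_class_iff[OF assms(1)] rep_as_class_iff[OF assms(2)]
    using fg by (simp add: as_eq_def)
  then show "as_class S T f = as_class S T g" by (simp add: as_class_def)
qed

lemma sample_map_comp:
  assumes "sample_map S T f" "sample_map T U g"
  shows "sample_map S U (g \<cdot> f)"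
proof -
  note f = sample_mapD[OF assms(1)] and g = sample_mapD[OF assms(2)]
  note [simp] = f(1-3)[THEN homD] g(1-3)[THEN homD]
  show ?thesis
    by (rule sample_mapI) (use f g in \<open>auto simp: hom_def intro: as_deterministic_comp\<close>)
qed

lemma comp_as_class:
  assumes "sample_map S T f" "sample_map T U g"
  shows "as_class T U g \<cdot>\<^bsub>Sample C\<^esub> as_class S T f = as_class S U (g \<cdot> f)"
proof -
  note f = sample_mapD[OF assms(1)] and g = sample_mapD[OF assms(2)]
  let ?G = "rep (as_class T U g)" and ?F = "rep (as_class S T f)"
  have class_eq: "as_rel C S U `` {g' \<cdot> f'} = as_rel C S U `` {g \<cdot> f}" if "f' \<in> ?F" "g' \<in> ?G" for f' g'
  proof -
    have f': "sample_map S T f'" "as_eq C (snd S) f f'"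
      and g': "sample_map T U g'" "as_eq C (snd T) g g'"
      using that by (auto simp: rep_as_class_iff[OF assms(1)] rep_as_class_iff[OF assms(2)])
    have "as_eq C (snd S) (g \<cdot> f) (g' \<cdot> f')"
      by (rule as_eq_comp[OF f(2,1) sample_mapD(1)[OF f'(1)] g(1) sample_mapD(1)[OF g'(1)] f'(2)])
         (simp add: f(4) g'(2))
    then have "as_class S U (g \<cdot> f) = as_class S U (g' \<cdot> f')"
      by (simp add: as_class_eq_iff sample_map_comp[OF assms] sample_map_comp[OF f'(1) g'(1)])
    then show ?thesis by (simp add: as_class_def)
  qed
  have "f \<in> ?F" "g \<in> ?G"
    by (auto simp: rep_as_class_iff[OF assms(1)] rep_as_class_iff[OF assms(2)] assms as_eq_refl)
  with class_eq have "(\<Union>f'\<in>?F. \<Union>g'\<in>?G. as_rel C S U `` {g' \<cdot> f'}) = as_rel C S U `` {g \<cdot> f}"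
    by blast
  then show ?thesis by (simp add: as_class_def Sample_def Prob_def)
qed

text \<open>The law of the triple is the same for all representatives, so those at hand may be used.\<close>

lemma independent_as_class_iff:
  assumes "sample_map W X f" "sample_map W Y g" "sample_map X Z u" "sample_map Y Z v"
  shows "independent C (as_class W X f) (as_class W Y g) (as_class X Z u) (as_class Y Z v) \<longleftrightarrow>
    as_eq C (snd W) (u \<cdot> f) (v \<cdot> g) \<and>
    (\<exists>\<phi>\<in>hom C (fst Z) (fst X). \<exists>\<psi>\<in>hom C (fst Z) (fst Y).
       \<langle>f, \<langle>u \<cdot> f, g\<rangle>\<rangle> \<cdot> snd W = \<langle>\<phi>, \<langle>\<iota> (fst Z), \<psi>\<rangle>\<rangle> \<cdot> snd Z)"
proof -
  note f = sample_mapD[OF assms(1)] and g = sample_mapD[OF assms(2)]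
  note uf = sample_map_comp[OF assms(1,3)] and vg = sample_map_comp[OF assms(2,4)]
  note d = sample_mapD[OF uf]
  have triple: "triple C a b c = \<langle>a, \<langle>b, c\<rangle>\<rangle>"
    if "a \<in> hom C A A'" "b \<in> hom C A B'" "c \<in> hom C A C'" for a b c A A' B' C'
    using that[THEN homD] by (simp add: triple_def pair_def)
  have comm: "comm_square (Sample C) (as_class W X f) (as_class W Y g) (as_class X Z u) (as_class Y Z v)
      \<longleftrightarrow> as_eq C (snd W) (u \<cdot> f) (v \<cdot> g)"
    using assms unfolding comm_square_def comp_as_class[OF assms(1,3)] comp_as_class[OF assms(2,4)]
      as_class_eq_iff[OF uf vg] hom_Sample_iff by blast
  have reps: "triple C f' d' g' \<cdot> snd W = \<langle>f, \<langle>u \<cdot> f, g\<rangle>\<rangle> \<cdot> snd W"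
    if "f' \<in> rep (as_class W X f)" "d' \<in> rep (as_class W Z (u \<cdot> f))" "g' \<in> rep (as_class W Y g)" for f' d' g'
  proof -
    have f': "f' \<in> hom C (fst W) (fst X)" "as_eq C (snd W) f f'"
      and d': "d' \<in> hom C (fst W) (fst Z)" "as_eq C (snd W) (u \<cdot> f) d'"
      and g': "g' \<in> hom C (fst W) (fst Y)" "as_eq C (snd W) g g'"
      using that by (auto simp: rep_as_class_iff[OF assms(1)] rep_as_class_iff[OF assms(2)] rep_as_class_iff[OF uf]
          dest: sample_mapD)
    note [simp] = f(1,2)[THEN homD] f'(1)[THEN homD] d(1)[THEN homD] d'(1)[THEN homD]
      g(1)[THEN homD] g'(1)[THEN homD]
    have "as_eq C (snd W) \<langle>u \<cdot> f, g\<rangle> \<langle>d', g'\<rangle>"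
      by (rule as_eq_pair[OF f(2) d(1) d'(1) g(1) g'(1) d'(2) g'(2)])
    then have "as_eq C (snd W) \<langle>f, \<langle>u \<cdot> f, g\<rangle>\<rangle> \<langle>f', \<langle>d', g'\<rangle>\<rangle>"
      by (rule as_eq_pair[OF f(2,1) f'(1) _ _ f'(2), rotated 2]) (auto simp: hom_def)
    then have "\<langle>f, \<langle>u \<cdot> f, g\<rangle>\<rangle> \<cdot> snd W = \<langle>f', \<langle>d', g'\<rangle>\<rangle> \<cdot> snd W"
      by (rule as_eq_state[OF f(2), rotated 2]) (auto simp: hom_def)
    then show ?thesis by (simp add: triple[OF f'(1) d'(1) g'(1)])
  qed
  have self: "f \<in> rep (as_class W X f)" "u \<cdot> f \<in> rep (as_class W Z (u \<cdot> f))" "g \<in> rep (as_class W Y g)"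
    by (simp_all add: rep_as_class_iff[OF assms(1)] rep_as_class_iff[OF assms(2)] rep_as_class_iff[OF uf] as_eq_refl
        assms uf)
  have target: "triple C \<phi> (\<iota> (fst Z)) \<psi> = \<langle>\<phi>, \<langle>\<iota> (fst Z), \<psi>\<rangle>\<rangle>"
    if "\<phi> \<in> hom C (fst Z) (fst X)" "\<psi> \<in> hom C (fst Z) (fst Y)" for \<phi> \<psi>
    using that by (intro triple) (auto simp: hom_def dest: Dom_Ob)
  have "independent C (as_class W X f) (as_class W Y g) (as_class X Z u) (as_class Y Z v) \<longleftrightarrow>
    as_eq C (snd W) (u \<cdot> f) (v \<cdot> g) \<and>
    (\<exists>f\<^sub>0\<in>rep (as_class W X f). \<exists>d\<^sub>0\<in>rep (as_class W Z (u \<cdot> f)). \<exists>g\<^sub>0\<in>rep (as_class W Y g).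
      \<exists>\<phi>\<in>hom C (fst Z) (fst X). \<exists>\<psi>\<in>hom C (fst Z) (fst Y).
        triple C f\<^sub>0 d\<^sub>0 g\<^sub>0 \<cdot> snd W = triple C \<phi> (\<iota> (fst Z)) \<psi> \<cdot> snd Z)"
    unfolding independent_def comm comp_as_class[OF assms(1,3)]
    by (simp add: Let_def as_class_def Sample_def Prob_def split: prod.split)
  also have "\<dots> \<longleftrightarrow> as_eq C (snd W) (u \<cdot> f) (v \<cdot> g) \<and>
    (\<exists>\<phi>\<in>hom C (fst Z) (fst X). \<exists>\<psi>\<in>hom C (fst Z) (fst Y).
       \<langle>f, \<langle>u \<cdot> f, g\<rangle>\<rangle> \<cdot> snd W = \<langle>\<phi>, \<langle>\<iota> (fst Z), \<psi>\<rangle>\<rangle> \<cdot> snd Z)"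
    using self by (auto simp: reps target)
  finally show ?thesis .
qed


section \<open>The apex of an independent pullback is determined by its two sides\<close>

text \<open>The map \<open>\<langle>h, g\<rangle>\<close> out of the apex \<open>X\<close> has an almost sure left inverse \<open>s\<close>. Let \<open>q\<close> be the law of
  \<open>\<langle>h, g\<rangle>\<close> and let \<open>s\<close> be the disintegration of \<open>p\<close> over it. Draw two points of \<open>X\<close> independently from \<open>s\<close>,
  given the same value of \<open>\<langle>h, g\<rangle>\<close>. This is a sample space \<open>S\<close> on \<open>X \<boxtimes> X\<close>, both of whose projections to
  \<open>X\<close> preserve the state and become equal after composing with \<open>h\<close> or with \<open>g\<close>. The common
  composites form an independent square, because the one on \<open>X\<close> is independent, and the uniqueness
  part of the universal property makes the two projections equal. So two independent draws from \<open>s\<close>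
  coincide, and hence a draw from \<open>s\<close> coincides with the point whose value of \<open>\<langle>h, g\<rangle>\<close> was given.\<close>

lemma independent_pullback_reconstruction:
  assumes sm: "sample_map X Y h" "sample_map X Y' g" "sample_map Y Z k" "sample_map Y' Z l"
    and pb: "independent_pullback C (as_class X Y h) (as_class X Y' g) (as_class Y Z k) (as_class Y' Z l)"
  obtains s where "s \<in> hom C (fst Y \<boxtimes> fst Y') (fst X)"
    "as_eq C (snd X) (s \<cdot> \<langle>h, g\<rangle>) (\<iota> (fst X))"
proof -
  let ?X = "fst X" and ?p = "snd X" and ?m = "\<langle>h, g\<rangle>"
  note h = sample_mapD[OF sm(1)] and g = sample_mapD[OF sm(2)]
    and k = sample_mapD[OF sm(3)] and l = sample_mapD[OF sm(4)]
  note [simp] = h(1,2)[THEN homD] g(1)[THEN homD] k(1)[THEN homD] l(1)[THEN homD]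
  define W where "W = fst Y \<boxtimes> fst Y'"
  define q where "q = ?m \<cdot> ?p"
  have m: "?m \<in> hom C ?X W" by (simp add: hom_def W_def)
  have W [simp]: "W \<in> Ob C" by (simp add: W_def)
  have q: "q \<in> hom C (unit C) W" by (simp add: q_def W_def hom_def)
  obtain s where s: "s \<in> hom C W ?X" and law: "\<langle>?m, \<iota> ?X\<rangle> \<cdot> ?p = \<langle>\<iota> W, s\<rangle> \<cdot> q"
    unfolding q_def by (rule disintegration[OF h(2) m, of "\<iota> ?X" ?X]) (auto simp: hom_def)
  note [simp] = q[THEN homD] s[THEN homD] m[THEN homD]
  have sq: "s \<cdot> q = ?p"
  proof -
    have "s \<cdot> q = \<pi>\<^sub>2 W ?X \<cdot> \<langle>\<iota> W, s\<rangle> \<cdot> q" by simp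
    also have "\<dots> = ?p" unfolding law[symmetric] by simp
    finally show ?thesis .
  qed

  define S where "S = (?X \<boxtimes> ?X, \<langle>s, s\<rangle> \<cdot> q)"
  have sndS: "snd S \<in> hom C (unit C) (?X \<boxtimes> ?X)" by (simp add: S_def hom_def)
  have proj: "sample_map S X (\<pi>\<^sub>1 ?X ?X)" "sample_map S X (\<pi>\<^sub>2 ?X ?X)"
    by (rule sample_mapI; simp add: S_def sq as_deterministic_proj hom_def)+

  \<comment> \<open>Here \<open>w\<close> stands for \<open>h\<close> or \<open>g\<close>, and \<open>t\<close> for the projection recovering it from \<open>\<langle>h, g\<rangle>\<close>. A draw from
    \<open>s\<close> at \<open>y\<close> satisfies \<open>w = t y\<close> almost surely, as the joint law of \<open>t\<close> and \<open>w \<cdot> s\<close> is diagonal; so \<open>w\<close> has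
    the same value at both points of \<open>S\<close>.\<close>
  have sides: "as_eq C (snd S) (w \<cdot> \<pi>\<^sub>1 ?X ?X) (w \<cdot> \<pi>\<^sub>2 ?X ?X)"
    if w: "w \<in> hom C ?X V" "as_deterministic C ?p w" and t: "t \<in> hom C W V" "t \<cdot> ?m = w"
      and t_det: "\<langle>t, t\<rangle> = copy C V \<cdot> t" for w t V
  proof -
    note [simp] = w(1)[THEN homD] t(1)[THEN homD]
    have tq: "t \<cdot> q = w \<cdot> ?p" using t(2) by (simp add: q_def flip: comp_assoc')
    have "\<langle>t, w \<cdot> s\<rangle> \<cdot> q = (t \<otimes> w) \<cdot> \<langle>\<iota> W, s\<rangle> \<cdot> q" by simp
    also have "\<dots> = \<langle>w, w\<rangle> \<cdot> ?p" unfolding law[symmetric] by (simp add: t(2))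
    also have "\<dots> = (copy C V \<cdot> w) \<cdot> ?p"
      by (rule as_eq_state[OF h(2) _ _ as_eq_sym[OF as_deterministic_copy[OF h(2) w]]])
         (simp_all add: hom_def)
    finally have tws: "\<langle>t, w \<cdot> s\<rangle> \<cdot> q = copy C V \<cdot> t \<cdot> q" by (simp add: tq)
    have ws: "w \<cdot> s \<in> hom C W V" by (simp add: hom_def)
    have t_eq: "as_eq C q t (w \<cdot> s)"
      by (rule as_eq_if_diagonal[OF q t(1) ws tws])
    have "\<langle>w \<cdot> \<pi>\<^sub>1 ?X ?X, w \<cdot> \<pi>\<^sub>2 ?X ?X\<rangle> \<cdot> snd S
        = (w \<otimes> w) \<cdot> \<langle>\<pi>\<^sub>1 ?X ?X, \<pi>\<^sub>2 ?X ?X\<rangle> \<cdot> \<langle>s, s\<rangle> \<cdot> q"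
      by (simp add: S_def)
    also have "\<dots> = \<langle>w \<cdot> s, w \<cdot> s\<rangle> \<cdot> q" by (simp add: copy_proj)
    also have "\<dots> = \<langle>t, t\<rangle> \<cdot> q"
      by (rule as_eq_state[OF q _ _ as_eq_pair[OF q ws t(1) ws t(1) as_eq_sym[OF t_eq] as_eq_sym[OF t_eq]]])
         (simp_all add: hom_def)
    also have "\<dots> = copy C V \<cdot> t \<cdot> q" by (simp add: t_det)
    also have "\<dots> = copy C V \<cdot> (w \<cdot> \<pi>\<^sub>1 ?X ?X) \<cdot> snd S" by (simp add: S_def sq tq)
    finally show ?thesis
      by (rule as_eq_if_diagonal[OF sndS, rotated 2]) (simp_all add: hom_def)
  qed
  have eq_h: "as_eq C (snd S) (h \<cdot> \<pi>\<^sub>1 ?X ?X) (h \<cdot> \<pi>\<^sub>2 ?X ?X)"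
    by (rule sides[OF h(1,5), of "\<pi>\<^sub>1 (fst Y) (fst Y')"]) (simp_all add: W_def hom_def copy_proj)
  have eq_g: "as_eq C (snd S) (g \<cdot> \<pi>\<^sub>1 ?X ?X) (g \<cdot> \<pi>\<^sub>2 ?X ?X)"
    by (rule sides[OF g(1,5), of "\<pi>\<^sub>2 (fst Y) (fst Y')"]) (simp_all add: W_def hom_def copy_proj)

  let ?h' = "as_class S Y (h \<cdot> \<pi>\<^sub>1 ?X ?X)" and ?g' = "as_class S Y' (g \<cdot> \<pi>\<^sub>1 ?X ?X)"
  have square: "as_eq C ?p (k \<cdot> h) (l \<cdot> g)"
    "\<exists>\<phi>\<in>hom C (fst Z) (fst Y). \<exists>\<psi>\<in>hom C (fst Z) (fst Y').
       \<langle>h, \<langle>k \<cdot> h, g\<rangle>\<rangle> \<cdot> ?p = \<langle>\<phi>, \<langle>\<iota> (fst Z), \<psi>\<rangle>\<rangle> \<cdot> snd Z"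
    using pb unfolding independent_pullback_def independent_as_class_iff[OF sm] by auto
  have "as_eq C (snd S) ((k \<cdot> h) \<cdot> \<pi>\<^sub>1 ?X ?X) ((l \<cdot> g) \<cdot> \<pi>\<^sub>1 ?X ?X)"
    by (rule as_eq_pre[OF sndS sample_mapD(1)[OF proj(1), unfolded S_def fst_conv]])
       (use square(1) in \<open>simp_all add: hom_def S_def sq\<close>)
  moreover have "\<langle>h \<cdot> \<pi>\<^sub>1 ?X ?X, \<langle>k \<cdot> h \<cdot> \<pi>\<^sub>1 ?X ?X, g \<cdot> \<pi>\<^sub>1 ?X ?X\<rangle>\<rangle> \<cdot> snd S
      = (\<langle>h, \<langle>k \<cdot> h, g\<rangle>\<rangle> \<cdot> \<pi>\<^sub>1 ?X ?X) \<cdot> snd S"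
    by simp
  moreover have "\<dots> = \<langle>h, \<langle>k \<cdot> h, g\<rangle>\<rangle> \<cdot> ?p"
    by (subst comp_assoc') (simp_all add: S_def sq)
  ultimately have "independent C ?h' ?g' (as_class Y Z k) (as_class Y' Z l)"
    unfolding independent_as_class_iff[OF sample_map_comp[OF proj(1) sm(1)]
        sample_map_comp[OF proj(1) sm(2)] sm(3,4)]
    using square(2) by simp
  then have "\<exists>!F. F \<in> hom (Sample C) S X \<and> as_class X Y h \<cdot>\<^bsub>Sample C\<^esub> F = ?h'
      \<and> as_class X Y' g \<cdot>\<^bsub>Sample C\<^esub> F = ?g'"
    using pb[unfolded independent_pullback_def, THEN conjunct2, rule_format, of ?h' ?g']
    by (simp only: Dom_as_class)
  moreover have "as_class X Y h \<cdot>\<^bsub>Sample C\<^esub> as_class S X (\<pi>\<^sub>2 ?X ?X) = ?h'"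
    unfolding comp_as_class[OF proj(2) sm(1)]
    by (simp add: as_class_eq_iff sample_map_comp[OF proj(1) sm(1)] sample_map_comp[OF proj(2) sm(1)]
        as_eq_sym eq_h)
  moreover have "as_class X Y' g \<cdot>\<^bsub>Sample C\<^esub> as_class S X (\<pi>\<^sub>2 ?X ?X) = ?g'"
    unfolding comp_as_class[OF proj(2) sm(2)]
    by (simp add: as_class_eq_iff sample_map_comp[OF proj(1) sm(2)] sample_map_comp[OF proj(2) sm(2)]
        as_eq_sym eq_g)
  moreover have "as_class X Y h \<cdot>\<^bsub>Sample C\<^esub> as_class S X (\<pi>\<^sub>1 ?X ?X) = ?h'"
    "as_class X Y' g \<cdot>\<^bsub>Sample C\<^esub> as_class S X (\<pi>\<^sub>1 ?X ?X) = ?g'"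
    by (rule comp_as_class[OF proj(1) sm(1)], rule comp_as_class[OF proj(1) sm(2)])
  moreover have "as_class S X (\<pi>\<^sub>1 ?X ?X) \<in> hom (Sample C) S X" "as_class S X (\<pi>\<^sub>2 ?X ?X) \<in> hom (Sample C) S X"
    unfolding hom_Sample_iff using proj by blast+
  ultimately have "as_class S X (\<pi>\<^sub>1 ?X ?X) = as_class S X (\<pi>\<^sub>2 ?X ?X)" by blast
  then have eq: "as_eq C (snd S) (\<pi>\<^sub>1 ?X ?X) (\<pi>\<^sub>2 ?X ?X)"
    by (simp add: as_class_eq_iff proj)

  \<comment> \<open>Equality of the projections says that the law of the two points is concentrated on the diagonal.\<close>
  have "\<langle>\<iota> ?X, \<iota> ?X\<rangle> \<cdot> ?p = (copy C ?X \<cdot> \<pi>\<^sub>1 ?X ?X) \<cdot> snd S"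
    by (simp add: S_def sq flip: pair_ident)
  also have "\<dots> = \<langle>\<pi>\<^sub>1 ?X ?X, \<pi>\<^sub>1 ?X ?X\<rangle> \<cdot> snd S"
    by (subst copy_proj(1)) simp_all
  also have "\<dots> = \<langle>\<pi>\<^sub>1 ?X ?X, \<pi>\<^sub>2 ?X ?X\<rangle> \<cdot> snd S"
    by (rule as_eqD[OF sndS _ _ _ eq]) (simp_all add: hom_def)
  also have "\<dots> = \<langle>s, s\<rangle> \<cdot> q"
    by (simp add: copy_proj(3) S_def)
  finally have diag: "\<langle>s, s\<rangle> \<cdot> q = \<langle>\<iota> ?X, \<iota> ?X\<rangle> \<cdot> ?p" ..
  have "\<langle>s \<cdot> ?m, \<iota> ?X\<rangle> \<cdot> ?p = (s \<otimes> \<iota> ?X) \<cdot> \<langle>?m, \<iota> ?X\<rangle> \<cdot> ?p" by simp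
  also have "\<dots> = \<langle>\<iota> ?X, \<iota> ?X\<rangle> \<cdot> ?p" unfolding law by (simp add: diag)
  finally have "\<sigma> ?X ?X \<cdot> \<langle>s \<cdot> ?m, \<iota> ?X\<rangle> \<cdot> ?p = \<sigma> ?X ?X \<cdot> \<langle>\<iota> ?X, \<iota> ?X\<rangle> \<cdot> ?p" by simp
  then have "as_eq C ?p (s \<cdot> ?m) (\<iota> ?X)" by (simp add: as_eq_def)
  with s show ?thesis by (intro that) (simp add: W_def)
qed


section \<open>Calculus of conditional independence\<close>

text \<open>Let \<open>a\<close> be independent of \<open>f\<close> given \<open>d\<close>, where \<open>d\<close> is almost surely \<open>e \<cdot> g \<cdot> f\<close>. Then the conditional law of
  \<open>a\<close> given \<open>f\<close> is \<open>\<phi> \<cdot> e \<cdot> g\<close>. It depends on \<open>f\<close> only through \<open>g \<cdot> f\<close>, which means that \<open>a\<close> is independent of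
  \<open>f\<close> given \<open>g \<cdot> f\<close>, with kernel \<open>\<phi> \<cdot> e\<close> for \<open>a\<close>; the kernel for \<open>f\<close> is its disintegration over \<open>g \<cdot> f\<close>.\<close>

lemma conditional_independence_weak_union:
  assumes homs: "p \<in> hom C (unit C) \<Omega>" "a \<in> hom C \<Omega> A" "f \<in> hom C \<Omega> X" "g \<in> hom C X Y"
      "e \<in> hom C Y Z" "d \<in> hom C \<Omega> Z"
    and r: "r \<in> hom C (unit C) Z" and \<phi>: "\<phi> \<in> hom C Z A" and \<psi>: "\<psi> \<in> hom C Z X"
    and det: "as_deterministic C p f" "as_deterministic C (f \<cdot> p) g"
    and d: "as_eq C p d (e \<cdot> g \<cdot> f)"
    and indep: "\<langle>a, \<langle>d, f\<rangle>\<rangle> \<cdot> p = \<langle>\<phi>, \<langle>\<iota> Z, \<psi>\<rangle>\<rangle> \<cdot> r"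
  obtains \<psi>' where "\<psi>' \<in> hom C Y X"
    "\<langle>a, \<langle>g \<cdot> f, f\<rangle>\<rangle> \<cdot> p = \<langle>\<phi> \<cdot> e, \<langle>\<iota> Y, \<psi>'\<rangle>\<rangle> \<cdot> g \<cdot> f \<cdot> p"
proof -
  note [simp] = homs[THEN homD] r[THEN homD] \<phi>[THEN homD] \<psi>[THEN homD]
  let ?x = "f \<cdot> p" and ?\<phi>' = "\<phi> \<cdot> e \<cdot> g"
  have x: "?x \<in> hom C (unit C) X" by (simp add: hom_def)
  obtain \<psi>' where \<psi>': "\<psi>' \<in> hom C Y X" and law: "\<langle>g, \<iota> X\<rangle> \<cdot> ?x = \<langle>\<iota> Y, \<psi>'\<rangle> \<cdot> g \<cdot> ?x"
    by (rule disintegration[OF x homs(4), of "\<iota> X" X]) (auto simp: hom_def)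
  note [simp] = \<psi>'[THEN homD]

  have "\<langle>a, f\<rangle> \<cdot> p = (\<iota> A \<otimes> \<pi>\<^sub>2 Z X) \<cdot> \<langle>a, \<langle>d, f\<rangle>\<rangle> \<cdot> p" by simp
  also have "\<dots> = (\<phi> \<otimes> \<iota> X) \<cdot> \<pi>\<^sub>2 A (Z \<boxtimes> X) \<cdot> \<langle>a, \<langle>d, f\<rangle>\<rangle> \<cdot> p" unfolding indep by simp
  also have "\<dots> = \<langle>\<phi> \<cdot> d, f\<rangle> \<cdot> p" by simp
  also have "as_eq C p (\<phi> \<cdot> d) (\<phi> \<cdot> e \<cdot> g \<cdot> f)"
    by (rule as_eq_post[OF homs(1,6) _ \<phi> d]) (simp add: hom_def)
  then have "as_eq C p \<langle>\<phi> \<cdot> d, f\<rangle> \<langle>\<phi> \<cdot> e \<cdot> g \<cdot> f, f\<rangle>"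
    by (rule as_eq_pair_right[OF homs(1), rotated 3]) (simp_all add: hom_def)
  then have "\<langle>\<phi> \<cdot> d, f\<rangle> \<cdot> p = \<langle>\<phi> \<cdot> e \<cdot> g \<cdot> f, f\<rangle> \<cdot> p"
    by (rule as_eq_state[OF homs(1), rotated 2]) (simp_all add: hom_def)
  also have "\<dots> = (\<langle>?\<phi>', \<iota> X\<rangle> \<cdot> f) \<cdot> p"
    using as_eq_state[OF homs(1) _ _ as_deterministic_pair[OF homs(1,3) _ _ det(1), of ?\<phi>' A "\<iota> X" X]]
    by (simp add: hom_def)
  finally have af: "\<langle>a, f\<rangle> \<cdot> p = \<langle>?\<phi>', \<iota> X\<rangle> \<cdot> ?x" by simp

  have "as_eq C p \<langle>g \<cdot> f, f\<rangle> (\<langle>g, \<iota> X\<rangle> \<cdot> f)"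
    using as_eq_sym[OF as_deterministic_pair[OF homs(1,3,4) _ det(1), of "\<iota> X" X]]
    by (simp add: hom_def)
  then have "\<langle>a, \<langle>g \<cdot> f, f\<rangle>\<rangle> \<cdot> p = \<langle>a, \<langle>g, \<iota> X\<rangle> \<cdot> f\<rangle> \<cdot> p"
    by (rule as_eqD[OF homs(1), rotated 3]) (simp_all add: hom_def)
  also have "\<dots> = (\<iota> A \<otimes> \<langle>g, \<iota> X\<rangle>) \<cdot> \<langle>a, f\<rangle> \<cdot> p" by simp
  also have "\<dots> = ((\<phi> \<cdot> e) \<otimes> \<iota> (Y \<boxtimes> X)) \<cdot> \<alpha> Y Y X \<cdot> \<langle>\<langle>g, g\<rangle>, \<iota> X\<rangle> \<cdot> ?x"
    unfolding af by simp
  also have "as_eq C ?x \<langle>\<langle>g, g\<rangle>, \<iota> X\<rangle> \<langle>copy C Y \<cdot> g, \<iota> X\<rangle>"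
    by (rule as_eq_pair_right[OF x _ _ _ as_eq_sym[OF as_deterministic_copy[OF x homs(4) det(2)]]])
       (simp_all add: hom_def)
  then have "\<langle>\<langle>g, g\<rangle>, \<iota> X\<rangle> \<cdot> ?x = \<langle>copy C Y \<cdot> g, \<iota> X\<rangle> \<cdot> ?x"
    by (rule as_eq_state[OF x, rotated 2]) (simp_all add: hom_def)
  also have "\<dots> = (copy C Y \<otimes> \<iota> X) \<cdot> \<langle>g, \<iota> X\<rangle> \<cdot> ?x" by simp
  also have "((\<phi> \<cdot> e) \<otimes> \<iota> (Y \<boxtimes> X)) \<cdot> \<alpha> Y Y X \<cdot> (copy C Y \<otimes> \<iota> X) \<cdot> \<langle>g, \<iota> X\<rangle> \<cdot> ?x
      = \<langle>\<phi> \<cdot> e, \<langle>\<iota> Y, \<psi>'\<rangle>\<rangle> \<cdot> g \<cdot> ?x"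
    unfolding law by (simp add: pair_ident)
  finally show ?thesis by (rule that[OF \<psi>'])
qed

text \<open>Independence of \<open>a\<close> and \<open>f\<close> given an almost surely deterministic \<open>b\<close> passes to anything computed, even at random,
  from \<open>a\<close> and \<open>b\<close>: duplicating \<open>b\<close> in the joint law hands a second copy of it to \<open>a\<close>.\<close>

lemma conditional_independence_function:
  assumes homs: "p \<in> hom C (unit C) \<Omega>" "a \<in> hom C \<Omega> A" "b \<in> hom C \<Omega> Y" "f \<in> hom C \<Omega> X"
      "s \<in> hom C (A \<boxtimes> Y) V"
    and q: "q \<in> hom C (unit C) Y" and \<phi>: "\<phi> \<in> hom C Y A" and \<psi>: "\<psi> \<in> hom C Y X"
    and det: "as_deterministic C p b"
    and indep: "\<langle>a, \<langle>b, f\<rangle>\<rangle> \<cdot> p = \<langle>\<phi>, \<langle>\<iota> Y, \<psi>\<rangle>\<rangle> \<cdot> q"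
  shows "\<langle>s \<cdot> \<langle>a, b\<rangle>, \<langle>b, f\<rangle>\<rangle> \<cdot> p = \<langle>s \<cdot> \<langle>\<phi>, \<iota> Y\<rangle>, \<langle>\<iota> Y, \<psi>\<rangle>\<rangle> \<cdot> q"
proof -
  note [simp] = homs[THEN homD] q[THEN homD] \<phi>[THEN homD] \<psi>[THEN homD]
    inv_arr[OF assoc_iso[of A Y "Y \<boxtimes> X"]] pair_assoc_inverse
  let ?H = "(s \<otimes> \<iota> (Y \<boxtimes> X)) \<cdot> inv_arr C (\<alpha> A Y (Y \<boxtimes> X)) \<cdot> (\<iota> A \<otimes> \<alpha> Y Y X)"
  have "\<langle>s \<cdot> \<langle>a, b\<rangle>, \<langle>b, f\<rangle>\<rangle> \<cdot> p = ?H \<cdot> \<langle>a, \<langle>\<langle>b, b\<rangle>, f\<rangle>\<rangle> \<cdot> p" by simp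
  also have "as_eq C p \<langle>\<langle>b, b\<rangle>, f\<rangle> \<langle>copy C Y \<cdot> b, f\<rangle>"
    by (rule as_eq_pair_right[OF homs(1) _ _ _ as_eq_sym[OF as_deterministic_copy[OF homs(1,3) det]]])
       (simp_all add: hom_def)
  then have "\<langle>a, \<langle>\<langle>b, b\<rangle>, f\<rangle>\<rangle> \<cdot> p = \<langle>a, \<langle>copy C Y \<cdot> b, f\<rangle>\<rangle> \<cdot> p"
    by (rule as_eqD[OF homs(1), rotated 3]) (simp_all add: hom_def)
  also have "?H \<cdot> \<langle>a, \<langle>copy C Y \<cdot> b, f\<rangle>\<rangle> \<cdot> p
      = ?H \<cdot> (\<iota> A \<otimes> (copy C Y \<otimes> \<iota> X)) \<cdot> \<langle>a, \<langle>b, f\<rangle>\<rangle> \<cdot> p" by simp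
  also have "\<dots> = \<langle>s \<cdot> \<langle>\<phi>, \<iota> Y\<rangle>, \<langle>\<iota> Y, \<psi>\<rangle>\<rangle> \<cdot> q"
    unfolding indep by (simp add: pair_ident)
  finally show ?thesis .
qed


text \<open>Write \<open>a = h\<^sub>1 f\<^sub>1\<close> and \<open>b = g\<^sub>2 f\<^sub>2\<close>. Independence of the composite square says that \<open>a\<close> and \<open>f\<^sub>2\<close> are
  independent given the common map \<open>h\<^sub>2 b\<close> to \<open>Z\<close>, hence given \<open>b\<close> by weak union, and \<open>f\<^sub>1\<close> is almost surely
  \<open>s \<cdot> \<langle>a, b\<rangle>\<close> with \<open>s\<close> from the pullback.\<close>

lemma independent_cancel_pullback:
  assumes sm: "sample_map \<Omega> X\<^sub>1 f\<^sub>1" "sample_map \<Omega> X\<^sub>2 f\<^sub>2" "sample_map X\<^sub>1 Y\<^sub>2 g\<^sub>1"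
      "sample_map X\<^sub>2 Y\<^sub>2 g\<^sub>2" "sample_map X\<^sub>1 Y\<^sub>1 h\<^sub>1" "sample_map Y\<^sub>2 Z h\<^sub>2" "sample_map Y\<^sub>1 Z k"
    and b: "as_eq C (snd \<Omega>) (g\<^sub>1 \<cdot> f\<^sub>1) (g\<^sub>2 \<cdot> f\<^sub>2)"
    and AB: "independent C (as_class \<Omega> Y\<^sub>1 (h\<^sub>1 \<cdot> f\<^sub>1)) (as_class \<Omega> X\<^sub>2 f\<^sub>2) (as_class Y\<^sub>1 Z k) (as_class X\<^sub>2 Z (h\<^sub>2 \<cdot> g\<^sub>2))"
    and pb: "independent_pullback C (as_class X\<^sub>1 Y\<^sub>1 h\<^sub>1) (as_class X\<^sub>1 Y\<^sub>2 g\<^sub>1) (as_class Y\<^sub>1 Z k) (as_class Y\<^sub>2 Z h\<^sub>2)"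
  shows "independent C (as_class \<Omega> X\<^sub>1 f\<^sub>1) (as_class \<Omega> X\<^sub>2 f\<^sub>2) (as_class X\<^sub>1 Y\<^sub>2 g\<^sub>1) (as_class X\<^sub>2 Y\<^sub>2 g\<^sub>2)"
proof -
  let ?p = "snd \<Omega>"
  note f1 = sample_mapD[OF sm(1)] and f2 = sample_mapD[OF sm(2)] and g1 = sample_mapD[OF sm(3)]
    and g2 = sample_mapD[OF sm(4)] and h1 = sample_mapD[OF sm(5)] and h2 = sample_mapD[OF sm(6)]
    and k = sample_mapD[OF sm(7)]
  note [simp] = f1(1,2)[THEN homD] f2(1)[THEN homD] g1(1)[THEN homD] g2(1)[THEN homD]
    h1(1)[THEN homD] h2(1)[THEN homD] k(1)[THEN homD] f1(4) f2(4)
  let ?a = "h\<^sub>1 \<cdot> f\<^sub>1" and ?b = "g\<^sub>2 \<cdot> f\<^sub>2"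
  have b_sample: "sample_map \<Omega> Y\<^sub>2 ?b" by (rule sample_map_comp[OF sm(2,4)])
  have "as_eq C ?p (k \<cdot> ?a) ((h\<^sub>2 \<cdot> g\<^sub>2) \<cdot> f\<^sub>2)"
    and "\<exists>\<phi>\<in>hom C (fst Z) (fst Y\<^sub>1). \<exists>\<psi>\<in>hom C (fst Z) (fst X\<^sub>2).
      \<langle>?a, \<langle>k \<cdot> ?a, f\<^sub>2\<rangle>\<rangle> \<cdot> ?p = \<langle>\<phi>, \<langle>\<iota> (fst Z), \<psi>\<rangle>\<rangle> \<cdot> snd Z"
    using AB unfolding
      independent_as_class_iff[OF sample_map_comp[OF sm(1,5)] sm(2,7) sample_map_comp[OF sm(4,6)]]
    by auto
  then obtain \<phi> \<psi> where d: "as_eq C ?p (k \<cdot> ?a) (h\<^sub>2 \<cdot> g\<^sub>2 \<cdot> f\<^sub>2)"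
    and \<phi>: "\<phi> \<in> hom C (fst Z) (fst Y\<^sub>1)" and \<psi>: "\<psi> \<in> hom C (fst Z) (fst X\<^sub>2)"
    and law: "\<langle>?a, \<langle>k \<cdot> ?a, f\<^sub>2\<rangle>\<rangle> \<cdot> ?p = \<langle>\<phi>, \<langle>\<iota> (fst Z), \<psi>\<rangle>\<rangle> \<cdot> snd Z"
    by auto
  note [simp] = \<phi>[THEN homD] \<psi>[THEN homD]
  obtain \<psi>' where \<psi>': "\<psi>' \<in> hom C (fst Y\<^sub>2) (fst X\<^sub>2)"
    and weak_union: "\<langle>?a, \<langle>?b, f\<^sub>2\<rangle>\<rangle> \<cdot> ?p = \<langle>\<phi> \<cdot> h\<^sub>2, \<langle>\<iota> (fst Y\<^sub>2), \<psi>'\<rangle>\<rangle> \<cdot> snd Y\<^sub>2"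
    by (rule conditional_independence_weak_union[OF f1(2) _ f2(1) g2(1) h2(1) _ h2(3) \<phi> \<psi> f2(5) _ d law])
       (use g2 in \<open>simp_all add: hom_def\<close>)
  obtain s where s: "s \<in> hom C (fst Y\<^sub>1 \<boxtimes> fst Y\<^sub>2) (fst X\<^sub>1)"
    and recon: "as_eq C (snd X\<^sub>1) (s \<cdot> \<langle>h\<^sub>1, g\<^sub>1\<rangle>) (\<iota> (fst X\<^sub>1))"
    by (rule independent_pullback_reconstruction[OF sm(5,3,7,6) pb])
  note [simp] = s[THEN homD] \<psi>'[THEN homD]

  have "as_eq C ?p ((s \<cdot> \<langle>h\<^sub>1, g\<^sub>1\<rangle>) \<cdot> f\<^sub>1) (\<iota> (fst X\<^sub>1) \<cdot> f\<^sub>1)"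
    by (rule as_eq_pre[OF f1(2,1)]) (simp_all add: recon hom_def)
  then have "as_eq C ?p f\<^sub>1 (s \<cdot> \<langle>h\<^sub>1, g\<^sub>1\<rangle> \<cdot> f\<^sub>1)"
    by (simp add: as_eq_sym)
  also have "as_eq C ?p \<dots> (s \<cdot> \<langle>?a, g\<^sub>1 \<cdot> f\<^sub>1\<rangle>)"
    by (rule as_eq_post[OF f1(2) _ _ s as_deterministic_pair[OF f1(2,1) h1(1) g1(1) f1(5)]])
       (simp_all add: hom_def)
  also have "as_eq C ?p \<dots> (s \<cdot> \<langle>?a, ?b\<rangle>)"
    by (rule as_eq_post[OF f1(2) _ _ s as_eq_pair_left[OF f1(2) _ _ _ b]])
       (simp_all add: hom_def)
  finally have f1_eq: "as_eq C ?p f\<^sub>1 (s \<cdot> \<langle>?a, ?b\<rangle>)" .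
  have "as_eq C ?p \<langle>g\<^sub>1 \<cdot> f\<^sub>1, f\<^sub>2\<rangle> \<langle>?b, f\<^sub>2\<rangle>"
    by (rule as_eq_pair_right[OF f1(2) _ _ _ b]) (simp_all add: hom_def)
  with f1_eq have "as_eq C ?p \<langle>f\<^sub>1, \<langle>g\<^sub>1 \<cdot> f\<^sub>1, f\<^sub>2\<rangle>\<rangle> \<langle>s \<cdot> \<langle>?a, ?b\<rangle>, \<langle>?b, f\<^sub>2\<rangle>\<rangle>"
    by (rule as_eq_pair[OF f1(2), rotated 4]) (simp_all add: hom_def)
  then have "\<langle>f\<^sub>1, \<langle>g\<^sub>1 \<cdot> f\<^sub>1, f\<^sub>2\<rangle>\<rangle> \<cdot> ?p = \<langle>s \<cdot> \<langle>?a, ?b\<rangle>, \<langle>?b, f\<^sub>2\<rangle>\<rangle> \<cdot> ?p"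
    by (rule as_eq_state[OF f1(2), rotated 2]) (simp_all add: hom_def)
  also have "\<dots> = \<langle>s \<cdot> \<langle>\<phi> \<cdot> h\<^sub>2, \<iota> (fst Y\<^sub>2)\<rangle>, \<langle>\<iota> (fst Y\<^sub>2), \<psi>'\<rangle>\<rangle> \<cdot> snd Y\<^sub>2"
    by (rule conditional_independence_function[OF f1(2) _ _ f2(1) s g2(3) _ \<psi>'
          sample_mapD(5)[OF b_sample] weak_union])
       (simp_all add: hom_def)
  finally show ?thesis
    unfolding independent_as_class_iff[OF sm(1-4)]
    by (intro conjI b bexI[of _ "s \<cdot> \<langle>\<phi> \<cdot> h\<^sub>2, \<iota> (fst Y\<^sub>2)\<rangle>"] bexI[of _ \<psi>'])
       (simp_all add: hom_def)
qed

end

theorem proposition19: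
  fixes C :: "('o, 'm, 'z) markov_scheme"
    and \<Omega> X\<^sub>1 X\<^sub>2 Y\<^sub>1 Y\<^sub>2 Z :: "('o, 'm) space"
    and f\<^sub>1 f\<^sub>2 g\<^sub>1 g\<^sub>2 h\<^sub>1 h\<^sub>2 k :: "('o, 'm) space_arr"
  assumes "markov_category C" and "has_conditionals C"
    and "f\<^sub>1 \<in> hom (Sample C) \<Omega> X\<^sub>1" and "f\<^sub>2 \<in> hom (Sample C) \<Omega> X\<^sub>2"
    and "g\<^sub>1 \<in> hom (Sample C) X\<^sub>1 Y\<^sub>2" and "g\<^sub>2 \<in> hom (Sample C) X\<^sub>2 Y\<^sub>2"
    and "h\<^sub>1 \<in> hom (Sample C) X\<^sub>1 Y\<^sub>1" and "h\<^sub>2 \<in> hom (Sample C) Y\<^sub>2 Z"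
    and "k \<in> hom (Sample C) Y\<^sub>1 Z"
    and "g\<^sub>1 \<cdot>\<^bsub>Sample C\<^esub> f\<^sub>1 = g\<^sub>2 \<cdot>\<^bsub>Sample C\<^esub> f\<^sub>2"
    and "k \<cdot>\<^bsub>Sample C\<^esub> h\<^sub>1 = h\<^sub>2 \<cdot>\<^bsub>Sample C\<^esub> g\<^sub>1"
    and "independent C (h\<^sub>1 \<cdot>\<^bsub>Sample C\<^esub> f\<^sub>1) f\<^sub>2 k (h\<^sub>2 \<cdot>\<^bsub>Sample C\<^esub> g\<^sub>2)"
    and "independent_pullback C h\<^sub>1 g\<^sub>1 k h\<^sub>2"
  shows "independent C f\<^sub>1 f\<^sub>2 g\<^sub>1 g\<^sub>2"
proof -
  interpret markov_category_with_conditionals C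
    by (intro markov_category_with_conditionals.intro
        markov_category_with_conditionals_axioms.intro assms(1,2))
  note arrs = assms(3-9)[unfolded hom_Sample_iff]
  obtain f\<^sub>1' where f\<^sub>1': "sample_map \<Omega> X\<^sub>1 f\<^sub>1'" "f\<^sub>1 = as_class \<Omega> X\<^sub>1 f\<^sub>1'"
    using arrs(1) by blast
  obtain f\<^sub>2' where f\<^sub>2': "sample_map \<Omega> X\<^sub>2 f\<^sub>2'" "f\<^sub>2 = as_class \<Omega> X\<^sub>2 f\<^sub>2'"
    using arrs(2) by blast
  obtain g\<^sub>1' where g\<^sub>1': "sample_map X\<^sub>1 Y\<^sub>2 g\<^sub>1'" "g\<^sub>1 = as_class X\<^sub>1 Y\<^sub>2 g\<^sub>1'"
    using arrs(3) by blast
  obtain g\<^sub>2' where g\<^sub>2': "sample_map X\<^sub>2 Y\<^sub>2 g\<^sub>2'" "g\<^sub>2 = as_class X\<^sub>2 Y\<^sub>2 g\<^sub>2'"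
    using arrs(4) by blast
  obtain h\<^sub>1' where h\<^sub>1': "sample_map X\<^sub>1 Y\<^sub>1 h\<^sub>1'" "h\<^sub>1 = as_class X\<^sub>1 Y\<^sub>1 h\<^sub>1'"
    using arrs(5) by blast
  obtain h\<^sub>2' where h\<^sub>2': "sample_map Y\<^sub>2 Z h\<^sub>2'" "h\<^sub>2 = as_class Y\<^sub>2 Z h\<^sub>2'"
    using arrs(6) by blast
  obtain k' where k': "sample_map Y\<^sub>1 Z k'" "k = as_class Y\<^sub>1 Z k'"
    using arrs(7) by blast
  note sm = f\<^sub>1'(1) f\<^sub>2'(1) g\<^sub>1'(1) g\<^sub>2'(1) h\<^sub>1'(1) h\<^sub>2'(1) k'(1)
    and as_class = f\<^sub>1'(2) f\<^sub>2'(2) g\<^sub>1'(2) g\<^sub>2'(2) h\<^sub>1'(2) h\<^sub>2'(2) k'(2)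
  have "as_eq C (snd \<Omega>) (comp C g\<^sub>1' f\<^sub>1') (comp C g\<^sub>2' f\<^sub>2')"
    using assms(10) unfolding as_class comp_as_class[OF sm(1,3)] comp_as_class[OF sm(2,4)]
      as_class_eq_iff[OF sample_map_comp[OF sm(1,3)] sample_map_comp[OF sm(2,4)]] .
  then show ?thesis
    using assms(12,13) unfolding as_class comp_as_class[OF sm(1,5)] comp_as_class[OF sm(4,6)]
    by (rule independent_cancel_pullback[OF sm])
qed

end
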